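(* Let $D$ be a non-trivial reduced $\mathbb{C}$-derivation of the polynomial ring $\mathbb{C}[x,y]$. Then $D$ is locally nilpotent if and only if $D$ is surjective and $\operatorname{Ker} D\supsetneqq\mathbb{C}$.
   Context: A $\mathbb{C}$-derivation $D=f_1\frac{\partial}{\partial x}+f_2\frac{\partial}{\partial y}$ of $\mathbb{C}[x,y]$, with $f_1,f_2\in\mathbb{C}[x,y]$, is reduced if $f_1$ and $f_2$ have no common irreducible factor. $D$ is non-trivial if $D\neq 0$. $D$ is locally nilpotent if for every $a$ there is $n\ge 1$ with $D^n(a)=0$. $D$ is surjective if it is surjective as a map $\mathbb{C}[x,y]\to\mathbb{C}[x,y]$. *)

theory Defs
  imports Complex_Main "HOL-Computational_Algebra.Computational_Algebra"
begin

text \<open>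
  The ring \<open>\<complex>[x,y]\<close> is represented as \<open>\<complex>[x][y]\<close>: the variable of the coefficient
  polynomials is \<open>x\<close>, the variable of the outer polynomial is \<open>y\<close>.
\<close>

type_synonym cpoly2 = "complex poly poly"

definition const2 :: "complex \<Rightarrow> cpoly2"
  where "const2 c = [:[:c:]:]"

definition varX :: cpoly2
  where "varX = [:[:0, 1:]:]"

definition varY :: cpoly2
  where "varY = [:0, 1:]"

definition dX :: "cpoly2 \<Rightarrow> cpoly2"
  where "dX = map_poly pderiv"

definition dY :: "cpoly2 \<Rightarrow> cpoly2"
  where "dY = pderiv"

definition C_derivation :: "(cpoly2 \<Rightarrow> cpoly2) \<Rightarrow> bool"
  where "C_derivation D \<longleftrightarrow>
    (\<forall>a b. D (a + b) = D a + D b) \<and>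
    (\<forall>c a. D (const2 c * a) = const2 c * D a) \<and>
    (\<forall>a b. D (a * b) = D a * b + a * D b)"

text \<open>
  The coefficients \<open>f\<^sub>1\<close>, \<open>f\<^sub>2\<close> exist for every derivation and are unique,
  see \<open>C_derivation_iff\<close> and \<open>C_derivation_coeffs\<close> below.
\<close>

definition reduced_derivation :: "(cpoly2 \<Rightarrow> cpoly2) \<Rightarrow> bool"
  where "reduced_derivation D \<longleftrightarrow>
    (\<exists>f\<^sub>1 f\<^sub>2. D = (\<lambda>a. f\<^sub>1 * dX a + f\<^sub>2 * dY a) \<and>
       \<not> (\<exists>p. irreducible p \<and> p dvd f\<^sub>1 \<and> p dvd f\<^sub>2))"

definition locally_nilpotent :: "(cpoly2 \<Rightarrow> cpoly2) \<Rightarrow> bool"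
  where "locally_nilpotent D \<longleftrightarrow> (\<forall>a. \<exists>n\<ge>1. (D ^^ n) a = 0)"

definition Ker :: "(cpoly2 \<Rightarrow> cpoly2) \<Rightarrow> cpoly2 set"
  where "Ker D = {a. D a = 0}"

lemma dX_pCons: "dX (pCons p q) = pCons (pderiv p) (dX q)"
  by (simp add: dX_def map_poly_pCons)

lemma dX_0 [simp]: "dX 0 = 0"
  by (simp add: dX_def)

lemma dX_add: "dX (a + b) = dX a + dX b"
  by (rule poly_eqI) (simp add: dX_def coeff_map_poly pderiv_add)

lemma dX_smult: "dX (smult p a) = smult (pderiv p) a + smult p (dX a)"
  by (rule poly_eqI) (simp add: dX_def coeff_map_poly pderiv_mult algebra_simps)

lemma dX_mult: "dX (a * b) = dX a * b + a * dX b"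
  by (induction a) (simp_all add: dX_pCons dX_add dX_smult mult_pCons_left algebra_simps)

lemma C_derivation_dX: "C_derivation dX"
  by (simp add: C_derivation_def const2_def dX_add dX_mult dX_smult pderiv_pCons)

lemma C_derivation_dY: "C_derivation dY"
  by (simp add: C_derivation_def const2_def dY_def pderiv_add pderiv_mult pderiv_smult algebra_simps)

lemma dX_X: "dX varX = 1" and dX_Y: "dX varY = 0" and dY_X: "dY varX = 0" and dY_Y: "dY varY = 1"
  by (simp_all add: varX_def varY_def dX_pCons dY_def pderiv_pCons one_pCons)

lemma C_derivation_coeffs:
  assumes "D = (\<lambda>a. f\<^sub>1 * dX a + f\<^sub>2 * dY a)"
  shows "f\<^sub>1 = D varX" and "f\<^sub>2 = D varY"
  by (simp_all add: assms dX_X dX_Y dY_X dY_Y)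

lemma C_derivation_iff:
  "C_derivation D \<longleftrightarrow> (\<exists>f\<^sub>1 f\<^sub>2. D = (\<lambda>a. f\<^sub>1 * dX a + f\<^sub>2 * dY a))"
proof
  assume D: "C_derivation D"
  have add: "D (a + b) = D a + D b" and mult: "D (a * b) = D a * b + a * D b"
    and scale: "D (const2 c * a) = const2 c * D a" for a b c
    using D by (auto simp: C_derivation_def)
  have D0: "D 0 = 0"
    using add[of 0 0] by simp
  have D1: "D 1 = 0"
    using mult[of 1 1] by simp
  have Dc: "D (const2 c) = 0" for c
    using scale[of c 1] by (simp add: D1)
  have inner: "D [:p:] = D varX * [:pderiv p:]" for p
  proof (induction p)
    case 0
    then show ?case by (simp add: D0)
  next
    case (pCons c p)
    have "[:pCons c p:] = const2 c + varX * [:p:]"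
      by (simp add: const2_def varX_def)
    then have "D [:pCons c p:] = D varX * [:p:] + varX * (D varX * [:pderiv p:])"
      by (simp only: add mult Dc pCons.IH add_0)
    also have "\<dots> = D varX * ([:p:] + varX * [:pderiv p:])"
      by (simp only: distrib_left mult.left_commute)
    also have "[:p:] + varX * [:pderiv p:] = [:pderiv (pCons c p):]"
      by (simp add: varX_def pderiv_pCons)
    finally show ?case .
  qed
  have "D a = D varX * dX a + D varY * dY a" for a
  proof (induction a)
    case 0
    then show ?case by (simp add: D0 dY_def)
  next
    case (pCons p q)
    have "pCons p q = [:p:] + varY * q"
      by (simp add: varY_def)
    then have "D (pCons p q) = D varX * ([:pderiv p:] + varY * dX q) + D varY * (q + varY * dY q)"
      by (simp add: add mult inner pCons.IH algebra_simps)
    also have "[:pderiv p:] + varY * dX q = dX (pCons p q)"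
      by (simp add: varY_def dX_pCons)
    also have "q + varY * dY q = dY (pCons p q)"
      by (simp add: varY_def dY_def pderiv_pCons)
    finally show ?case .
  qed
  then show "\<exists>f\<^sub>1 f\<^sub>2. D = (\<lambda>a. f\<^sub>1 * dX a + f\<^sub>2 * dY a)"
    by blast
next
  assume "\<exists>f\<^sub>1 f\<^sub>2. D = (\<lambda>a. f\<^sub>1 * dX a + f\<^sub>2 * dY a)"
  then show "C_derivation D"
    using C_derivation_dX C_derivation_dY
    by (auto simp: C_derivation_def algebra_simps)
qed

end

theory Submission
  imports Defs "HOL-Computational_Algebra.Field_as_Ring" "HOL-Complex_Analysis.Cauchy_Integral_Formula"
begin

text \<open>
  Let \<open>D\<close> be locally nilpotent, nonzero and reduced. The last nonzero iterate of \<open>D\<close> on a suitable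
  element is \<open>\<rho> = D r\<close> with \<open>D \<rho> = 0\<close>. Suppose that a prime \<open>p\<close> divides \<open>\<rho>\<close>. Then \<open>D p = 0\<close>, because
  the kernel of a locally nilpotent derivation contains all factors of its nonzero elements, and so \<open>D\<close>
  acts on \<open>\<complex>[x,y]/(p)\<close>. This is a domain of transcendence degree one over \<open>\<complex>\<close> on which \<open>D\<close> does not
  vanish, as \<open>D\<close> is reduced; hence its only constants are the complex numbers
  (\<open>constant_modulo_invariant_prime\<close>). So \<open>p\<close> divides \<open>r - c\<close> for some \<open>c \<in> \<complex>\<close>, and \<open>D\<close> maps
  \<open>(r - c)/p\<close> to \<open>\<rho>/p\<close>, which has fewer prime factors. After finitely many steps there is a slice
  \<open>s\<close>, that is, \<open>D s = 1\<close>. Integration by parts against powers of \<open>s\<close> shows that \<open>D\<close> is surjective. Every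
  polynomial is congruent modulo \<open>s\<close> to an element of the kernel; a kernel equal to \<open>\<complex>\<close> would make
  \<open>s\<close> divide \<open>x - c\<close> and \<open>y - d\<close> for two complex numbers.

  Conversely let \<open>D\<close> be surjective, \<open>D s = 1\<close>, and let \<open>f\<close> be a nonconstant element of the kernel. For a
  point \<open>P\<close> the formal integral curve of \<open>D\<close> through \<open>P\<close> gives a ring homomorphism
  \<open>a \<mapsto> \<Sum>\<^sub>k (D\<^sup>k a)(P) u\<^sup>k / k!\<close> into \<open>\<complex>[[u]]\<close>, which turns \<open>D\<close> into \<open>d/du\<close>. Its image \<open>S\<close> contains
  \<open>\<complex>[u]\<close>, is closed under derivatives, contains a primitive of each of its elements, and has finite
  rank over \<open>\<complex>[u]\<close> because \<open>f\<close> becomes a constant. These properties force \<open>S = \<complex>[u]\<close>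
  (\<open>surjective_differential_subring_polynomial\<close>), in three steps.

  \<^item> The trace of \<open>S\<close> over \<open>\<complex>(u)\<close> commutes with \<open>d/du\<close>, so it maps \<open>S\<close> into rational functions that have
    rational primitives. A pole of a trace could be made simple by a polynomial factor, and a function
    with a simple pole has no rational primitive. Hence all traces are polynomials, and as the trace
    form is nondegenerate, \<open>S\<close> embeds into a free \<open>\<complex>[u]\<close>-module and is finitely generated.
  \<^item> Finitely many generators of this module satisfy a linear differential equation with polynomial
    coefficients, so all elements of \<open>S\<close> are entire functions.
  \<^item> An element of \<open>S\<close> acts on the generators by a matrix of polynomials, which bounds its growth by a
    polynomial. By Liouville's theorem it is a polynomial.

  So at each point \<open>P\<close> some iterate \<open>D\<^sup>n a\<close> has expansion zero. Take one point on each fibre \<open>f = c\<close>. There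
  are uncountably many \<open>c\<close>, so one \<open>n\<close> serves infinitely many fibres, and then \<open>D\<^sup>n a = 0\<close>: otherwise
  \<open>D\<^sup>n a\<close> would divide a nontrivial expression \<open>\<Sum>\<^sub>i Q\<^sub>i(f) s\<^sup>i\<close>, and expanding it on these fibres would
  give \<open>Q\<^sub>i\<close> infinitely many zeros \<open>c\<close>.

  All statements on transcendence degree are obtained from one dimension count,
  \<open>finite_rank_over_polynomials_modulo\<close>.
\<close>

section \<open>Counting dimensions in the plane\<close>

lemma homogeneous_system_nontrivial_solution:
  fixes M :: "'i \<Rightarrow> 'j \<Rightarrow> 'a::field"
  assumes "finite I" "finite J" "card J < card I"
  shows "\<exists>c. (\<exists>i\<in>I. c i \<noteq> 0) \<and> (\<forall>j\<in>J. (\<Sum>i\<in>I. c i * M i j) = 0)"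
  using assms(2,1,3)
proof (induction J arbitrary: I M rule: finite_induct)
  case empty
  then obtain i where "i \<in> I"
    by (auto simp: card_gt_0_iff)
  then show ?case
    by (intro exI[of _ "\<lambda>_. 1"]) auto
next
  case (insert j0 J)
  show ?case
  proof (cases "\<forall>i\<in>I. M i j0 = 0")
    case True
    obtain c where "\<exists>i\<in>I. c i \<noteq> 0" "\<forall>j\<in>J. (\<Sum>i\<in>I. c i * M i j) = 0"
      using insert.IH[of I M] insert.prems insert.hyps by auto
    then show ?thesis
      using True by (intro exI[of _ c]) auto
  next
    case False
    then obtain i0 where i0: "i0 \<in> I" "M i0 j0 \<noteq> 0" by blast
    define N where "N i j = M i j - M i j0 / M i0 j0 * M i0 j" for i j
    have "card J < card (I - {i0})"
      using insert.prems insert.hyps i0 by simp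
    then obtain c where c: "\<exists>i\<in>I - {i0}. c i \<noteq> 0" "\<And>j. j \<in> J \<Longrightarrow> (\<Sum>i\<in>I - {i0}. c i * N i j) = 0"
      using insert.IH[of "I - {i0}" N] insert.prems by auto
    define d where "d = c(i0 := - (\<Sum>i\<in>I - {i0}. c i * (M i j0 / M i0 j0)))"
    have d_sum: "(\<Sum>i\<in>I. d i * M i j) = (\<Sum>i\<in>I - {i0}. c i * N i j)" for j
    proof -
      have "(\<Sum>i\<in>I. d i * M i j) = d i0 * M i0 j + (\<Sum>i\<in>I - {i0}. d i * M i j)"
        using i0 insert.prems by (simp add: sum.remove)
      also have "(\<Sum>i\<in>I - {i0}. d i * M i j) = (\<Sum>i\<in>I - {i0}. c i * M i j)"
        by (intro sum.cong) (auto simp: d_def)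
      finally show ?thesis
        by (simp add: d_def N_def algebra_simps sum_subtractf sum_distrib_left)
    qed
    have "\<forall>j\<in>insert j0 J. (\<Sum>i\<in>I. d i * M i j) = 0"
      unfolding d_sum using c(2) i0(2) by (auto simp: N_def)
    moreover have "\<exists>i\<in>I. d i \<noteq> 0"
      using c(1) by (auto simp: d_def)
    ultimately show ?thesis by blast
  qed
qed

definition box :: "nat \<Rightarrow> cpoly2 set"
  where "box M = {q. degree q \<le> M \<and> (\<forall>i. degree (coeff q i) \<le> M)}"

lemma box_mult:
  assumes "p \<in> box M" "q \<in> box N"
  shows "p * q \<in> box (M + N)"
proof -
  have "degree (p * q) \<le> M + N"
    using assms degree_mult_le[of p q] by (auto simp: box_def)
  moreover have "degree (coeff p i * coeff q j) \<le> M + N" for i j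
    using assms degree_mult_le[of "coeff p i" "coeff q j"]
    by (simp add: box_def) (meson add_mono order_trans)
  ultimately show ?thesis
    by (auto simp: box_def coeff_mult intro!: degree_sum_le)
qed

lemma box_power: "p \<in> box M \<Longrightarrow> p ^ n \<in> box (M * n)"
proof (induction n)
  case 0
  show ?case by (auto simp: box_def)
next
  case (Suc n)
  then show ?case using box_mult[of p M "p ^ n" "M * n"] by simp
qed

lemma box_mono: "M \<le> N \<Longrightarrow> box M \<subseteq> box N"
  by (auto simp: box_def intro: order_trans)

lemma box_exhaust: "\<exists>M. q \<in> box M"
proof -
  have "degree (coeff q i) \<le> degree q + (\<Sum>j\<le>degree q. degree (coeff q j))" for i
  proof (cases "i \<le> degree q")
    case True
    then have "degree (coeff q i) \<le> (\<Sum>j\<le>degree q. degree (coeff q j))"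
      by (intro member_le_sum) auto
    then show ?thesis by simp
  qed (simp add: coeff_eq_0)
  then show ?thesis
    by (auto simp: box_def intro!: exI[of _ "degree q + (\<Sum>j\<le>degree q. degree (coeff q j))"])
qed

lemma coeff_const2_mult: "coeff (coeff (const2 c * v) k) l = c * coeff (coeff v k) l"
  by (simp add: const2_def)

lemma box_linearly_dependent:
  assumes "finite I" "\<And>i. i \<in> I \<Longrightarrow> v i \<in> box M" "(M + 1)\<^sup>2 < card I"
  shows "\<exists>c. (\<exists>i\<in>I. c i \<noteq> 0) \<and> (\<Sum>i\<in>I. const2 (c i) * v i) = 0"
proof -
  have "card ({..M} \<times> {..M}) < card I"
    using assms(3) by (simp add: power2_eq_square)
  from homogeneous_system_nontrivial_solution[OF assms(1) _ this,
      where M = "\<lambda>i (k, l). coeff (coeff (v i) k) l"]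
  obtain c where nz: "\<exists>i\<in>I. c i \<noteq> 0"
    and c: "\<And>k l. k \<le> M \<Longrightarrow> l \<le> M \<Longrightarrow> (\<Sum>i\<in>I. c i * coeff (coeff (v i) k) l) = 0"
    by fastforce
  have "(\<Sum>i\<in>I. c i * coeff (coeff (v i) k) l) = 0" for k l
  proof (cases "k \<le> M \<and> l \<le> M")
    case False
    have "coeff (coeff (v i) k) l = 0" if "i \<in> I" for i
      using False assms(2)[OF that]
      by (auto simp: box_def coeff_eq_0 not_le)
        (metis coeff_eq_0 le_less_trans)
    then show ?thesis by simp
  qed (use c in auto)
  then have "(\<Sum>i\<in>I. const2 (c i) * v i) = 0"
    by (intro poly_eqI) (simp add: coeff_sum coeff_const2_mult)
  with nz show ?thesis by blast
qed

definition at_poly :: "complex poly \<Rightarrow> cpoly2 \<Rightarrow> cpoly2"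
  where "at_poly q s = poly (map_poly const2 q) s"

lemma const2_hom: "const2 0 = 0" "const2 1 = 1" "const2 (a + b) = const2 a + const2 b"
  "const2 (a * b) = const2 a * const2 b" "const2 (- a) = - const2 a" "const2 (a - b) = const2 a - const2 b"
  by (simp_all add: const2_def one_pCons)

lemma const2_eq_0 [simp]: "const2 c = 0 \<longleftrightarrow> c = 0"
  by (simp add: const2_def)

lemma at_poly_0 [simp]: "at_poly 0 s = 0"
  by (simp add: at_poly_def)

lemma at_poly_pCons: "at_poly (pCons c q) s = const2 c + s * at_poly q s"
  by (simp add: at_poly_def map_poly_pCons const2_hom)

lemma at_poly_add: "at_poly (p + q) s = at_poly p s + at_poly q s"
proof (induction p arbitrary: q)
  case (pCons c p)
  obtain d q' where "q = pCons d q'" by (cases q)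
  then show ?case
    by (simp add: at_poly_pCons pCons.IH const2_hom algebra_simps)
qed simp

lemma at_poly_smult: "at_poly (smult c q) s = const2 c * at_poly q s"
  by (induction q) (simp_all add: at_poly_pCons const2_hom algebra_simps)

lemma at_poly_mult: "at_poly (p * q) s = at_poly p s * at_poly q s"
  by (induction p) (simp_all add: at_poly_pCons at_poly_add at_poly_smult const2_hom algebra_simps)

lemma at_poly_monom: "at_poly (monom c n) s = const2 c * s ^ n"
  by (induction n) (simp_all add: monom_0 monom_Suc at_poly_pCons const2_hom algebra_simps)

lemma at_poly_sum: "at_poly (sum f A) s = (\<Sum>i\<in>A. at_poly (f i) s)"
  by (induction A rule: infinite_finite_induct) (simp_all add: at_poly_add)

text \<open>
  The curve \<open>p = 0\<close> has dimension one, so over \<open>\<complex>[s]\<close> its coordinate ring has bounded rank. With degrees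
  at most about \<open>N\<close> in each variable, reduction modulo \<open>p\<close> leaves a space of dimension linear in \<open>N\<close>; the
  products \<open>s\<^sup>j b\<^sub>i\<close> with \<open>j \<le> N\<close> and \<open>i \<le> m\<close> outnumber it for large \<open>N\<close> once \<open>m\<close> is large enough, and
  this \<open>m\<close> depends on \<open>p\<close> and \<open>s\<close> only.
\<close>

theorem finite_rank_over_polynomials_modulo:
  assumes "p \<noteq> 0"
  shows "\<exists>m. \<forall>b :: nat \<Rightarrow> cpoly2. \<exists>Q. (\<exists>i\<le>m. Q i \<noteq> 0) \<and> p dvd (\<Sum>i\<le>m. at_poly (Q i) s * b i)"
proof -
  obtain k where k: "p \<in> box k" using box_exhaust by blast
  obtain \<sigma> where \<sigma>: "s \<in> box \<sigma>" using box_exhaust by blast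
  \<comment> \<open>With \<open>L\<close> below, multiples of \<open>p\<close> by polynomials of degrees \<open>\<le> L\<close> have codimension about \<open>2 k L\<close>, which grows like \<open>2 k \<sigma> N\<close>.\<close>
  define m where "m = 2 * k * \<sigma>"
  have "\<exists>Q. (\<exists>i\<le>m. Q i \<noteq> 0) \<and> p dvd (\<Sum>i\<le>m. at_poly (Q i) s * b i)" for b :: "nat \<Rightarrow> cpoly2"
  proof -
    have "\<forall>i. \<exists>M. b i \<in> box M" using box_exhaust by blast
    then obtain e' where e': "\<And>i. b i \<in> box (e' i)" by metis
    define e where "e = (\<Sum>i\<le>m. e' i)"
    have e: "b i \<in> box e" if "i \<le> m" for i
      using box_mono[of "e' i" e] e'[of i] that by (auto simp: e_def intro!: member_le_sum)
    define N where "N = 2 * k * (e + k + 1)"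
    define L where "L = \<sigma> * N + e"
    \<comment> \<open>The left summand indexes the products \<open>s\<^sup>j b\<^sub>i\<close>, the right one the monomial multiples of \<open>p\<close>.\<close>
    define I where "I = ({..m} \<times> {..N}) <+> ({..L} \<times> {..L})"
    define v where "v = case_sum (\<lambda>(i, j). s ^ j * b i) (\<lambda>(i, j). p * monom (monom 1 j) i)"
    have fin: "finite I" by (simp add: I_def)
    have "(L + k + 1)\<^sup>2 = (L + 1)\<^sup>2 + 2 * k * \<sigma> * N + (2 * k * (e + 1) + k * k)"
      by (simp add: L_def power2_eq_square algebra_simps)
    also have "2 * k * (e + 1) + k * k < m + N + 1"
      by (simp add: N_def algebra_simps)
    also have "(L + 1)\<^sup>2 + 2 * k * \<sigma> * N + (m + N + 1) = (L + 1)\<^sup>2 + (m + 1) * (N + 1)"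
      by (simp add: m_def algebra_simps)
    also have "\<dots> = card I"
      by (simp add: I_def card_Plus power2_eq_square)
    finally have card: "(L + k + 1)\<^sup>2 < card I" by simp
    have vbox: "v z \<in> box (L + k)" if "z \<in> I" for z
    proof -
      from that have "z \<in> ({..m} \<times> {..N}) <+> ({..L} \<times> {..L})"
        by (simp only: I_def)
      then consider (l) i j where "z = Inl (i, j)" "i \<le> m" "j \<le> N"
        | (r) i j where "z = Inr (i, j)" "i \<le> L" "j \<le> L"
        by (elim PlusE SigmaE) auto
      then show ?thesis
      proof cases
        case l
        have "s ^ j * b i \<in> box (\<sigma> * j + e)"
          by (rule box_mult[OF box_power[OF \<sigma>] e]) (rule l)
        moreover have "\<sigma> * j + e \<le> L + k"
          using l by (simp add: L_def trans_le_add1)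
        ultimately have "s ^ j * b i \<in> box (L + k)"
          using box_mono by (meson subsetD)
        then show ?thesis by (simp add: v_def l)
      next
        case r
        have "monom (monom 1 j) i \<in> box L"
          using r by (auto simp: box_def coeff_monom degree_monom_eq)
        then have "p * monom (monom 1 j) i \<in> box (k + L)"
          by (rule box_mult[OF k])
        then show ?thesis by (simp add: v_def r add.commute)
      qed
    qed
    obtain c where nz: "\<exists>i\<in>I. c i \<noteq> 0" and c: "(\<Sum>i\<in>I. const2 (c i) * v i) = 0"
      using box_linearly_dependent[of I v, OF fin vbox card] by blast
    define Q where "Q i = (\<Sum>j\<le>N. monom (c (Inl (i, j))) j)" for i
    define h where "h = (\<Sum>i\<le>L. \<Sum>j\<le>L. monom (monom (c (Inr (i, j))) j) i)"
    have "(\<Sum>i\<in>I. const2 (c i) * v i)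
        = (\<Sum>z\<in>{..m} \<times> {..N}. const2 (c (Inl z)) * v (Inl z))
          + (\<Sum>z\<in>{..L} \<times> {..L}. const2 (c (Inr z)) * v (Inr z))"
      by (simp add: I_def sum.Plus)
    also have "(\<Sum>z\<in>{..m} \<times> {..N}. const2 (c (Inl z)) * v (Inl z)) = (\<Sum>i\<le>m. at_poly (Q i) s * b i)"
      by (simp add: v_def Q_def at_poly_sum at_poly_monom sum_distrib_right sum.cartesian_product
          split_def mult.assoc)
    also have "(\<Sum>z\<in>{..L} \<times> {..L}. const2 (c (Inr z)) * v (Inr z)) = p * h"
    proof -
      have "const2 d * (p * monom (monom 1 j) i) = p * monom (monom d j) i" for d i j
      proof -
        have "const2 d * monom (monom 1 j) i = monom (monom d j) i"
          by (simp add: const2_def smult_monom)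
        then show ?thesis by (metis mult.left_commute)
      qed
      note scaled = this
      show ?thesis
        by (simp only: v_def h_def sum_distrib_left sum.cartesian_product split_def sum.case scaled prod.collapse)
    qed
    finally have eq: "(\<Sum>i\<le>m. at_poly (Q i) s * b i) = p * (- h)"
      using c by (simp add: eq_neg_iff_add_eq_0)
    have "\<exists>i\<le>m. Q i \<noteq> 0"
    proof (rule ccontr)
      assume "\<not> ?thesis"
      then have Q0: "Q i = 0" if "i \<le> m" for i using that by blast
      then have "h = 0" using eq assms by simp
      have Qc: "coeff (Q i) j = c (Inl (i, j))" if "j \<le> N" for i j
        using that by (simp add: Q_def coeff_sum coeff_monom)
      have hc: "coeff (coeff h i) j = c (Inr (i, j))" if "i \<le> L" "j \<le> L" for i j
      proof -
        have "coeff (coeff h i) j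
            = (\<Sum>i'\<le>L. \<Sum>j'\<le>L. coeff (coeff (monom (monom (c (Inr (i', j'))) j') i') i) j)"
          by (simp only: h_def coeff_sum)
        also have "\<dots> = (\<Sum>i'\<le>L. if i' = i then c (Inr (i, j)) else 0)"
        proof (intro sum.cong refl)
          fix i' show "(\<Sum>j'\<le>L. coeff (coeff (monom (monom (c (Inr (i', j'))) j') i') i) j)
              = (if i' = i then c (Inr (i, j)) else 0)"
            using that by (cases "i' = i") (simp_all add: coeff_monom)
        qed
        finally show ?thesis using that by simp
      qed
      have "c z = 0" if "z \<in> I" for z
        using that unfolding I_def
      proof (elim PlusE SigmaE)
        fix w i j assume "z = Inl w" "w = (i, j)" "i \<in> {..m}" "j \<in> {..N}"
        then show ?thesis using Q0[of i] Qc[of j i] by simp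
      next
        fix w i j assume "z = Inr w" "w = (i, j)" "i \<in> {..L}" "j \<in> {..L}"
        then show ?thesis using hc[of i j] \<open>h = 0\<close> by simp
      qed
      with nz show False by blast
    qed
    with eq show ?thesis by (intro exI[of _ Q] conjI) (auto intro: dvdI)
  qed
  then show ?thesis by blast
qed

section \<open>Derivations of the plane\<close>

lemma of_nat_eq_const2: "(of_nat n :: cpoly2) = const2 (of_nat n)"
  by (induction n) (simp_all add: const2_hom)

lemma const2_inverse: "c \<noteq> 0 \<Longrightarrow> const2 c * const2 (inverse c) = 1"
  by (simp flip: const2_hom)

locale plane_derivation =
  fixes D :: "cpoly2 \<Rightarrow> cpoly2"
  assumes derivation: "C_derivation D"
begin

lemma D_add: "D (a + b) = D a + D b"
  and D_scale: "D (const2 c * a) = const2 c * D a"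
  and D_mult: "D (a * b) = D a * b + a * D b"
  using derivation by (auto simp: C_derivation_def)

lemma D_0 [simp]: "D 0 = 0"
  using D_add[of 0 0] by simp

lemma D_1 [simp]: "D 1 = 0"
  using D_mult[of 1 1] by simp

lemma D_const2 [simp]: "D (const2 c) = 0"
  using D_scale[of c 1] by simp

lemma D_of_nat [simp]: "D (of_nat n) = 0"
  by (simp add: of_nat_eq_const2)

lemma D_minus: "D (- a) = - D a"
  using D_add[of a "- a"] by (simp add: eq_neg_iff_add_eq_0 add.commute)

lemma D_diff: "D (a - b) = D a - D b"
  using D_add[of a "- b"] by (simp add: D_minus)

lemma D_sum: "D (sum f A) = (\<Sum>i\<in>A. D (f i))"
  by (induction A rule: infinite_finite_induct) (simp_all add: D_add)

lemma D_power_Suc: "D (s ^ Suc k) = of_nat (Suc k) * s ^ k * D s"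
  by (induction k) (simp_all add: D_mult algebra_simps)

lemma D_at_poly: "D (at_poly q s) = at_poly (pderiv q) s * D s"
  by (induction q) (simp_all add: at_poly_pCons pderiv_pCons at_poly_add D_add D_mult const2_hom algebra_simps)

lemma iterate_0 [simp]: "(D ^^ n) 0 = 0"
  by (induction n) simp_all

lemma iterate_add: "(D ^^ n) (a + b) = (D ^^ n) a + (D ^^ n) b"
  by (induction n) (simp_all add: D_add)

lemma iterate_vanishes_beyond: "(D ^^ m) a = 0 \<Longrightarrow> m \<le> n \<Longrightarrow> (D ^^ n) a = 0"
  by (metis funpow_add iterate_0 le_add_diff_inverse2 o_apply)

lemma iterated_Leibniz:
  "(D ^^ n) (a * b) = (\<Sum>i\<le>n. of_nat (n choose i) * (D ^^ i) a * (D ^^ (n - i)) b)"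
proof (induction n)
  case (Suc n)
  define f where "f i = (D ^^ i) a" for i
  define g where "g i = (D ^^ i) b" for i
  have "(D ^^ Suc n) (a * b) = D (\<Sum>i\<le>n. of_nat (n choose i) * f i * g (n - i))"
    by (simp add: Suc.IH f_def g_def)
  also have "\<dots> = (\<Sum>i\<le>n. of_nat (n choose i) * f (Suc i) * g (n - i))
      + (\<Sum>i\<le>n. of_nat (n choose i) * f i * g (Suc n - i))"
    by (simp add: D_sum D_mult f_def g_def algebra_simps sum.distrib Suc_diff_le)
  also have "(\<Sum>i\<le>n. of_nat (n choose i) * f i * g (Suc n - i))
      = (\<Sum>i\<le>Suc n. of_nat (n choose i) * f i * g (Suc n - i))"
    by simp
  also have "\<dots> = f 0 * g (Suc n) + (\<Sum>i\<le>n. of_nat (n choose Suc i) * f (Suc i) * g (n - i))"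
    by (subst sum.atMost_Suc_shift) simp
  also have "(\<Sum>i\<le>n. of_nat (n choose i) * f (Suc i) * g (n - i)) + \<dots>
      = f 0 * g (Suc n) + (\<Sum>i\<le>n. of_nat (Suc n choose Suc i) * f (Suc i) * g (n - i))"
    by (simp add: sum.distrib algebra_simps)
  also have "\<dots> = (\<Sum>i\<le>Suc n. of_nat (Suc n choose i) * f i * g (Suc n - i))"
    by (subst sum.atMost_Suc_shift) simp
  finally show ?case by (simp only: f_def g_def)
qed simp

end

lemma prime_dvd_at_poly:
  assumes "prime_elem p" "Q \<noteq> 0" "p dvd at_poly Q b"
  shows "\<exists>c. p dvd b - const2 c"
  using assms(2,3)
proof (induction "degree Q" arbitrary: Q rule: less_induct)
  case less
  show ?case
  proof (cases "degree Q = 0")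
    case True
    then obtain c where c: "Q = [:c:]" by (metis degree_eq_zeroE)
    then have "p dvd const2 c * const2 (inverse c)"
      using less.prems by (simp add: at_poly_pCons)
    then show ?thesis
      using c less.prems const2_inverse[of c] assms(1) by (auto simp: prime_elem_def)
  next
    case False
    then obtain z where "poly Q z = 0"
      using Fundamental_Theorem_Algebra.fundamental_theorem_of_algebra[of Q] False by (auto simp: constant_degree)
    then obtain R where R: "Q = [:- z, 1:] * R"
      by (metis poly_eq_0_iff_dvd dvdE)
    then have "R \<noteq> 0" "degree R < degree Q"
      using less.prems by (auto simp: degree_mult_eq simp del: mult_pCons_left)
    moreover have "p dvd (b - const2 z) * at_poly R b"
      using less.prems(2) unfolding R at_poly_mult by (simp add: at_poly_pCons const2_hom)
    ultimately show ?thesis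
      using less.hyps[of R] assms(1) prime_elem_dvd_mult_iff by blast
  qed
qed

context plane_derivation
begin

text \<open>
  In \<open>\<complex>[x,y]/(p)\<close> the elements \<open>b\<close> and \<open>r\<close> are algebraically dependent. Differentiating a relation of least
  degree in \<open>r\<close> with coefficients in \<open>\<complex>[b]\<close> lowers that degree, because \<open>D b\<close> vanishes and \<open>D r\<close> does not.
  So the least degree is zero, \<open>b\<close> is algebraic over \<open>\<complex>\<close>, and it lies in \<open>\<complex>\<close> since the quotient is a
  domain.
\<close>

lemma constant_modulo_invariant_prime:
  assumes p: "prime_elem p" "p dvd D p" and r: "\<not> p dvd D r" and b: "p dvd D b"
  shows "\<exists>c. p dvd b - const2 c"
proof -
  define rel where "rel n Q \<longleftrightarrow> Q n \<noteq> 0 \<and> p dvd (\<Sum>i\<le>n. at_poly (Q i) b * r ^ i)"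
    for n and Q :: "nat \<Rightarrow> complex poly"
  have "p \<noteq> 0" using p(1) by auto
  then obtain m Q where Q: "\<exists>i\<le>m. Q i \<noteq> 0" "p dvd (\<Sum>i\<le>m. at_poly (Q i) b * r ^ i)"
    using finite_rank_over_polynomials_modulo[of p b] by metis
  define n where "n = Max {i. i \<le> m \<and> Q i \<noteq> 0}"
  have fin: "finite {i. i \<le> m \<and> Q i \<noteq> 0}" by simp
  have "n \<in> {i. i \<le> m \<and> Q i \<noteq> 0}"
    unfolding n_def using fin Q(1) by (intro Max_in) auto
  moreover have "Q i = 0" if "i \<le> m" "i > n" for i
  proof (rule ccontr)
    assume "Q i \<noteq> 0"
    then have "i \<le> n" unfolding n_def using that fin by (intro Max_ge) auto
    with that show False by simp
  qed
  then have "(\<Sum>i\<le>m. at_poly (Q i) b * r ^ i) = (\<Sum>i\<le>n. at_poly (Q i) b * r ^ i)"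
    using calculation by (intro sum.mono_neutral_right) (auto simp: not_le)
  ultimately have "\<exists>n Q. rel n Q"
    using Q(2) by (auto simp: rel_def)
  define n0 where "n0 = (LEAST n. \<exists>Q. rel n Q)"
  have n0: "\<exists>Q. rel n0 Q"
    unfolding n0_def by (rule LeastI_ex) fact
  have min: "n0 \<le> n" if "rel n Q" for n Q
    unfolding n0_def using that by (intro Least_le) auto
  obtain Q0 where Q0: "rel n0 Q0" using n0 by blast
  have "n0 = 0"
  proof (rule ccontr)
    assume "n0 \<noteq> 0"
    then obtain k where k: "n0 = Suc k" by (cases n0) auto
    define S where "S = (\<Sum>i\<le>Suc k. at_poly (Q0 i) b * r ^ i)"
    have "p dvd S" using Q0 by (simp add: rel_def S_def k)
    then have "p dvd D S"
      using p(2) by (auto simp: dvd_def D_mult) (metis distrib_left mult.assoc)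
    have "D S = (\<Sum>i\<le>Suc k. at_poly (pderiv (Q0 i)) b * r ^ i) * D b
        + (\<Sum>i\<le>Suc k. at_poly (Q0 i) b * D (r ^ i))"
    proof -
      have "D (at_poly (Q0 i) b * r ^ i)
          = at_poly (pderiv (Q0 i)) b * r ^ i * D b + at_poly (Q0 i) b * D (r ^ i)" for i
        by (simp add: D_mult D_at_poly)
      then show ?thesis
        by (simp only: S_def D_sum sum.distrib sum_distrib_right)
    qed
    then have "p dvd (\<Sum>i\<le>Suc k. at_poly (Q0 i) b * D (r ^ i))"
      using \<open>p dvd D S\<close> dvd_add_right_iff[OF dvd_mult[OF b]] by (simp only:)
    also have "(\<Sum>i\<le>Suc k. at_poly (Q0 i) b * D (r ^ i))
        = (\<Sum>i\<le>k. at_poly (Q0 (Suc i)) b * D (r ^ Suc i))"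
      by (subst sum.atMost_Suc_shift) simp
    also have "\<dots> = D r * (\<Sum>i\<le>k. at_poly (smult (of_nat (Suc i)) (Q0 (Suc i))) b * r ^ i)"
      unfolding D_power_Suc at_poly_smult of_nat_eq_const2 sum_distrib_left
      by (intro sum.cong refl) (simp add: mult_ac)
    finally have "rel k (\<lambda>i. smult (of_nat (Suc i)) (Q0 (Suc i)))"
      using p(1) r Q0 by (auto simp: rel_def k prime_elem_dvd_mult_iff simp del: of_nat_Suc)
    from min[OF this] k show False by simp
  qed
  then have "Q0 0 \<noteq> 0" "p dvd at_poly (Q0 0) b"
    using Q0 by (auto simp: rel_def)
  then show ?thesis
    using prime_dvd_at_poly[OF p(1)] by blast
qed

text \<open>
  Integration by parts: \<open>s\<^sup>k a\<close> and \<open>- s\<^sup>k\<^sup>+\<^sup>1 (D a) / (k + 1)\<close> differ by \<open>D (s\<^sup>k\<^sup>+\<^sup>1 a / (k + 1))\<close>, and \<open>D a\<close> dies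
  one step earlier than \<open>a\<close>. The power of \<open>s\<close> is there for the induction.
\<close>

lemma slice_nilpotent_in_image:
  assumes "D s = 1" "(D ^^ n) a = 0"
  shows "\<exists>b. D b = s ^ k * a"
  using assms(2)
proof (induction n arbitrary: a k)
  case 0
  then show ?case by (intro exI[of _ 0]) simp
next
  case (Suc n)
  have "(D ^^ n) (D a) = 0"
    using Suc.prems by (simp add: funpow_swap1)
  then obtain b where b: "D b = s ^ Suc k * D a"
    using Suc.IH by blast
  have "D (s ^ Suc k * a - b) = const2 (of_nat (Suc k)) * (s ^ k * a)"
    unfolding D_diff b D_mult D_power_Suc assms(1) of_nat_eq_const2
    by (simp only: mult_1_right mult.assoc add_diff_cancel_right')
  then have "D (const2 (inverse (of_nat (Suc k))) * (s ^ Suc k * a - b))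
      = const2 (of_nat (Suc k)) * const2 (inverse (of_nat (Suc k))) * (s ^ k * a)"
    by (simp only: D_scale) (simp only: mult_ac)
  also have "\<dots> = s ^ k * a"
    by (subst const2_inverse) (simp_all del: of_nat_Suc)
  finally show ?case by blast
qed

text \<open>
  For \<open>k = 0\<close> the equation reads \<open>D (s b) = c\<close>, so that \<open>a\<close> can be corrected by a multiple of \<open>s\<close> to lie in
  the kernel: take \<open>c = - D a\<close>. Larger \<open>k\<close> are needed for the induction, which puts \<open>b = c/(k + 1) + s b'\<close>.
\<close>

lemma slice_kernel_complement:
  assumes "D s = 1" "(D ^^ n) c = 0"
  shows "\<exists>b. of_nat (Suc k) * b + s * D b = c"
  using assms(2)
proof (induction n arbitrary: c k)
  case 0
  then show ?case by (intro exI[of _ 0]) simp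
next
  case (Suc n)
  define c1 where "c1 = const2 (inverse (of_nat (Suc k))) * c"
  have c1: "of_nat (Suc k) * c1 = c"
    unfolding c1_def of_nat_eq_const2 mult.assoc[symmetric]
    by (subst const2_inverse) (simp_all del: of_nat_Suc)
  have "(D ^^ Suc n) c1 = const2 (inverse (of_nat (Suc k))) * (D ^^ Suc n) c" for n
    unfolding c1_def by (induction n) (simp_all add: D_scale)
  then have "(D ^^ n) (- D c1) = 0"
    using Suc.prems iterate_add[of n "- D c1" "D c1"] by (simp add: funpow_swap1)
  then obtain b where b: "of_nat (Suc (Suc k)) * b + s * D b = - D c1"
    using Suc.IH by blast
  have "of_nat (Suc k) * (c1 + s * b) + s * D (c1 + s * b)
      = of_nat (Suc k) * c1 + s * (of_nat (Suc (Suc k)) * b + s * D b + D c1)"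
    by (simp add: D_add D_mult assms(1) algebra_simps)
  also have "\<dots> = c"
    by (simp add: b c1 del: of_nat_Suc)
  finally show ?case by blast
qed

end

section \<open>Locally nilpotent derivations have a slice\<close>

lemma not_dvd_both_coordinates:
  assumes "s dvd varX - const2 c" "s dvd varY - const2 d"
  shows "\<exists>k. s = const2 k"
proof -
  obtain h where h: "varX - const2 c = s * h" using assms(1) by blast
  have eq: "varX - const2 c = [:[:- c, 1:]:]"
    by (simp add: varX_def const2_def)
  then have "s * h \<noteq> 0" "degree (s * h) = 0"
    using h by auto
  then have "degree s = 0"
    by (auto simp: degree_mult_eq)
  then obtain q where q: "s = [:q:]" by (metis degree_eq_zeroE)
  obtain g where "varY - const2 d = [:q:] * g" using assms(2) q by blast
  then have "coeff (varY - const2 d) 1 = coeff ([:q:] * g) 1" by simp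
  then have "q dvd 1"
    by (simp add: varY_def const2_def) (metis dvd_triv_left)
  then show ?thesis
    using q by (auto simp: const2_def is_unit_poly_iff)
qed

locale locally_nilpotent_derivation = plane_derivation +
  assumes nilpotent: "locally_nilpotent D"
begin

lemma last_nonzero_iterate:
  assumes "a \<noteq> 0"
  obtains n where "(D ^^ n) a \<noteq> 0" "(D ^^ Suc n) a = 0"
proof -
  obtain N where N: "(D ^^ N) a = 0"
    using nilpotent by (auto simp: locally_nilpotent_def)
  define m where "m = (LEAST m. (D ^^ m) a = 0)"
  have m: "(D ^^ m) a = 0"
    unfolding m_def by (rule LeastI) (rule N)
  with assms obtain n where n: "m = Suc n" by (cases m) auto
  then have "(D ^^ n) a \<noteq> 0"
    using not_less_Least[of n "\<lambda>m. (D ^^ m) a = 0"] by (auto simp: m_def)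
  with m n that show ?thesis by blast
qed

text \<open>
  If \<open>n\<close> and \<open>m\<close> are the orders of the last nonzero iterates of \<open>a\<close> and \<open>b\<close>, the Leibniz formula for
  \<open>D\<^sup>n\<^sup>+\<^sup>m (a b)\<close> has a single nonzero term. So orders add up, and the kernel consists of the elements of
  order zero.
\<close>

lemma kernel_factorially_closed:
  assumes "D (a * b) = 0" "a * b \<noteq> 0"
  shows "D a = 0"
proof (rule ccontr)
  assume "D a \<noteq> 0"
  obtain n where n: "(D ^^ n) a \<noteq> 0" "(D ^^ Suc n) a = 0"
    using last_nonzero_iterate[of a] assms(2) by auto
  obtain m where m: "(D ^^ m) b \<noteq> 0" "(D ^^ Suc m) b = 0"
    using last_nonzero_iterate[of b] assms(2) by auto
  have "n > 0"
    using n \<open>D a \<noteq> 0\<close> by (cases n) auto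
  then have "(D ^^ (n + m)) (a * b) = 0"
    using assms(1) iterate_vanishes_beyond[of 1 "a * b" "n + m"] by simp
  moreover have "(D ^^ (n + m)) (a * b)
      = (\<Sum>i\<le>n + m. if i = n then of_nat (n + m choose n) * (D ^^ n) a * (D ^^ m) b else 0)"
    unfolding iterated_Leibniz
  proof (intro sum.cong refl)
    fix i assume "i \<in> {..n + m}"
    consider "i = n" | "i \<ge> Suc n" | "i < n" by linarith
    then show "of_nat (n + m choose i) * (D ^^ i) a * (D ^^ (n + m - i)) b =
        (if i = n then of_nat (n + m choose n) * (D ^^ n) a * (D ^^ m) b else 0)"
    proof cases
      case 2
      then show ?thesis using iterate_vanishes_beyond[OF n(2)] by auto
    next
      case 3
      then show ?thesis using iterate_vanishes_beyond[OF m(2), of "n + m - i"] by auto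
    qed simp
  qed
  ultimately show False
    using n m by (simp add: of_nat_eq_const2)
qed

text \<open>
  Each prime factor \<open>p\<close> of \<open>D r\<close> can be divided out: \<open>r\<close> is constant modulo \<open>p\<close>, and \<open>(r - c)/p\<close> is again
  annihilated by \<open>D\<^sup>2\<close>.
\<close>

lemma slice_from_local_slice:
  assumes no_common: "\<And>p. prime_elem p \<Longrightarrow> \<not> (p dvd D varX \<and> p dvd D varY)"
    and "D r \<noteq> 0" "D (D r) = 0"
  shows "\<exists>s. D s = 1"
  using assms(2,3)
proof (induction "size (prime_factorization (D r))" arbitrary: r rule: less_induct)
  case less
  show ?case
  proof (cases "is_unit (D r)")
    case True
    then obtain u where u: "D r * u = 1" by (metis dvdE)
    then have "D (D r * u) = 0" by simp
    then have "D u = 0"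
      using less.prems by (simp add: D_mult)
    then have "D (r * u) = 1"
      using u by (simp add: D_mult)
    then show ?thesis by blast
  next
    case False
    then obtain p where p: "p dvd D r" "prime p"
      using prime_divisor_exists less.prems by blast
    then obtain k where k: "D r = p * k" by blast
    have "D p = 0"
      using kernel_factorially_closed[of p k] k less.prems by simp
    have "prime_elem p" using p by simp
    then have "\<not> p dvd D varX \<or> \<not> p dvd D varY"
      using no_common by blast
    then obtain c where "p dvd r - const2 c"
      using constant_modulo_invariant_prime[of p _ r] \<open>prime_elem p\<close> \<open>D p = 0\<close> p(1) by auto
    then obtain r' where r': "r - const2 c = p * r'" by blast
    have "p * D r' = D (r - const2 c)"
      by (simp add: r' D_mult \<open>D p = 0\<close>)
    also have "\<dots> = p * k" by (simp add: D_diff k)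
    finally have Dr': "D r' = k" using p by auto
    have "k \<noteq> 0" using k less.prems by auto
    moreover have "D (D r') = 0"
      using less.prems(2) \<open>D p = 0\<close> p(2) by (auto simp: k Dr' D_mult)
    moreover have "size (prime_factorization (D r')) < size (prime_factorization (D r))"
      using p \<open>k \<noteq> 0\<close> by (simp add: k Dr' prime_factorization_mult prime_factorization_prime)
    ultimately show ?thesis
      using less.hyps[of r'] Dr' by simp
  qed
qed

lemma nonconstant_kernel_element:
  assumes s: "D s = 1"
  shows "\<exists>f. D f = 0 \<and> f \<notin> range const2"
proof (rule ccontr)
  assume neg: "\<not> ?thesis"
  have "\<exists>c. s dvd a - const2 c" for a
  proof -
    obtain n where "(D ^^ n) (- D a) = 0"
      using nilpotent by (auto simp: locally_nilpotent_def)
    then obtain b where b: "of_nat (Suc 0) * b + s * D b = - D a"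
      using slice_kernel_complement[OF s] by blast
    have "D (a + s * b) = 0"
      using b by (simp add: D_add D_mult s)
    then obtain c where "a + s * b = const2 c" using neg by auto
    then have "a - const2 c = s * (- b)" by (simp add: algebra_simps)
    then show ?thesis by (metis dvd_triv_left)
  qed
  then obtain k where "s = const2 k"
    using not_dvd_both_coordinates by blast
  with s show False by simp
qed

lemma surjective_and_nontrivial_kernel:
  assumes nz: "D \<noteq> (\<lambda>_. 0)"
    and no_common: "\<And>p. prime_elem p \<Longrightarrow> \<not> (p dvd D varX \<and> p dvd D varY)"
  shows "surj D \<and> range const2 \<subset> Ker D"
proof -
  obtain a where "D a \<noteq> 0" using nz by auto
  then obtain n where "(D ^^ n) (D a) \<noteq> 0" "(D ^^ Suc n) (D a) = 0"
    using last_nonzero_iterate by blast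
  then have "D ((D ^^ n) a) \<noteq> 0" "D (D ((D ^^ n) a)) = 0"
    by (simp_all add: funpow_swap1)
  then obtain s where s: "D s = 1"
    using slice_from_local_slice[OF no_common] by blast
  have "\<exists>b. a = D b" for a
    using slice_nilpotent_in_image[OF s, of _ a 0] nilpotent
    by (fastforce simp: locally_nilpotent_def)
  then have "surj D" by (simp add: surj_def)
  moreover have "range const2 \<subset> Ker D"
    using nonconstant_kernel_element[OF s] by (auto simp: Ker_def)
  ultimately show ?thesis by blast
qed

end

section \<open>Surjective differential rings of finite rank over polynomials\<close>

text \<open>
  The derivative of a pole of order \<open>m > 0\<close> is a pole of order \<open>m + 1\<close>, never a simple one. The equation
  is \<open>(\<alpha>/\<beta>)' = p/(u - z)\<close> with the denominators cleared.
\<close>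

lemma derivative_no_simple_pole:
  fixes \<alpha> \<beta> p :: "complex poly"
  assumes "(pderiv \<alpha> * \<beta> - \<alpha> * pderiv \<beta>) * [:- z, 1:] = p * \<beta>\<^sup>2"
    and "\<beta> \<noteq> 0" "poly \<alpha> z \<noteq> 0 \<or> poly \<beta> z \<noteq> 0"
  shows "poly p z = 0"
proof (cases "poly \<beta> z = 0")
  case False
  have "poly (p * \<beta>\<^sup>2) z = 0"
    by (simp flip: assms(1))
  with False show ?thesis by simp
next
  case True
  define l where "l = [:- z, 1:]"
  define m where "m = order z \<beta>"
  obtain \<gamma> where \<gamma>: "\<beta> = l ^ m * \<gamma>" "\<not> l dvd \<gamma>"
    using order_decomp[OF assms(2)] by (auto simp: l_def m_def)
  have "m \<noteq> 0"
    using True assms(2) by (simp add: m_def order_root)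
  then obtain k where k: "m = Suc k" by (cases m) auto
  have \<gamma>z: "poly \<gamma> z \<noteq> 0"
    using \<gamma>(2) by (simp add: l_def poly_eq_0_iff_dvd)
  have "pderiv l = 1" by (simp add: l_def pderiv_pCons one_pCons)
  then have "pderiv \<beta> * l = l ^ m * (smult (of_nat m) \<gamma> + l * pderiv \<gamma>)"
    unfolding \<gamma>(1) k pderiv_mult pderiv_power_Suc by (simp add: algebra_simps)
  then have "(pderiv \<alpha> * \<beta> - \<alpha> * pderiv \<beta>) * l
      = l ^ m * (pderiv \<alpha> * \<gamma> * l - \<alpha> * (smult (of_nat m) \<gamma> + l * pderiv \<gamma>))"
    unfolding left_diff_distrib mult.assoc by (simp only: \<gamma>(1)) (simp only: algebra_simps)
  also have "(pderiv \<alpha> * \<beta> - \<alpha> * pderiv \<beta>) * l = l ^ m * (p * l ^ m * \<gamma>\<^sup>2)"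
    unfolding l_def assms(1) by (simp add: \<gamma>(1) l_def power2_eq_square mult_ac)
  finally have "p * l ^ m * \<gamma>\<^sup>2 = pderiv \<alpha> * \<gamma> * l - \<alpha> * (smult (of_nat m) \<gamma> + l * pderiv \<gamma>)"
    by (simp add: l_def)
  then have "poly (p * l ^ m * \<gamma>\<^sup>2) z
      = poly (pderiv \<alpha> * \<gamma> * l - \<alpha> * (smult (of_nat m) \<gamma> + l * pderiv \<gamma>)) z"
    by simp
  then have "poly \<alpha> z = 0"
    using \<gamma>z by (simp add: l_def k del: of_nat_Suc)
  with True assms(3) show ?thesis by blast
qed

text \<open>
  The subring \<open>R\<close> of a field is an algebra over \<open>\<complex>[u]\<close> through \<open>\<iota>\<close> and carries an extension \<open>d\<close> of \<open>d/du\<close>.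
  The last assumption says that \<open>R\<close> has finite rank over \<open>\<complex>[u]\<close>; together with the surjectivity of \<open>d\<close>
  on \<open>R\<close> it implies that \<open>R\<close> is a finitely generated module.
\<close>

locale surjective_differential_ring =
  fixes \<iota> :: "complex poly \<Rightarrow> 'a::field" and d :: "'a \<Rightarrow> 'a" and R :: "'a set"
  assumes iota_add: "\<iota> (p + q) = \<iota> p + \<iota> q"
    and iota_mult: "\<iota> (p * q) = \<iota> p * \<iota> q"
    and iota_1: "\<iota> 1 = 1"
    and iota_inj: "\<iota> p = 0 \<Longrightarrow> p = 0"
    and d_add: "d (x + y) = d x + d y"
    and d_mult: "d (x * y) = d x * y + x * d y"
    and d_iota: "d (\<iota> p) = \<iota> (pderiv p)"
    and R_add: "x \<in> R \<Longrightarrow> y \<in> R \<Longrightarrow> x + y \<in> R"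
    and R_mult: "x \<in> R \<Longrightarrow> y \<in> R \<Longrightarrow> x * y \<in> R"
    and iota_in_R: "\<iota> p \<in> R"
    and d_image: "d ` R = R"
    and finite_rank: "\<exists>m. \<forall>b :: nat \<Rightarrow> 'a. (\<forall>i. b i \<in> R) \<longrightarrow>
      (\<exists>Q. (\<exists>i\<le>m. Q i \<noteq> 0) \<and> (\<Sum>i\<le>m. \<iota> (Q i) * b i) = 0)"
begin

lemma iota_0 [simp]: "\<iota> 0 = 0"
  using iota_add[of 0 0] by (metis add.right_neutral add_left_cancel)

lemma iota_eq_0 [simp]: "\<iota> p = 0 \<longleftrightarrow> p = 0"
  using iota_inj by auto

lemma iota_minus: "\<iota> (- p) = - \<iota> p"
  using iota_add[of p "- p"] by (simp add: eq_neg_iff_add_eq_0 add.commute)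

lemma iota_diff: "\<iota> (p - q) = \<iota> p - \<iota> q"
  using iota_add[of p "- q"] by (simp add: iota_minus)

lemma iota_of_nat: "\<iota> (of_nat n) = of_nat n"
  by (induction n) (simp_all add: iota_add iota_1)

lemma iota_power: "\<iota> (p ^ n) = \<iota> p ^ n"
  by (induction n) (simp_all add: iota_1 iota_mult)

lemma d_0 [simp]: "d 0 = 0"
  using d_add[of 0 0] by (metis add.right_neutral add_left_cancel)

lemma d_sum: "d (sum f A) = (\<Sum>i\<in>A. d (f i))"
  by (induction A rule: infinite_finite_induct) (simp_all add: d_add)

lemma R_0: "0 \<in> R" and R_1: "1 \<in> R"
  using iota_in_R[of 0] iota_in_R[of 1] by (simp_all add: iota_1)

lemma R_minus: "x \<in> R \<Longrightarrow> - x \<in> R"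
  using R_mult[OF iota_in_R[of "- 1"], of x] by (simp add: iota_minus iota_1)

lemma R_sum: "(\<And>i. i \<in> A \<Longrightarrow> f i \<in> R) \<Longrightarrow> sum f A \<in> R"
  by (induction A rule: infinite_finite_induct) (auto simp: R_0 R_add)

lemma R_power: "x \<in> R \<Longrightarrow> x ^ n \<in> R"
  by (induction n) (auto simp: R_1 R_mult)

lemma d_R: "x \<in> R \<Longrightarrow> d x \<in> R"
  using d_image by blast

lemma R_primitive: "y \<in> R \<Longrightarrow> \<exists>x\<in>R. d x = y"
  using d_image by (metis imageE)

text \<open>
  The copy of the field \<open>\<complex>(u)\<close> inside the ambient field.
\<close>

definition K :: "'a set"
  where "K = {\<iota> p / \<iota> q | p q. q \<noteq> 0}"

lemma K_iota: "\<iota> p \<in> K"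
  unfolding K_def by (rule CollectI, rule exI[of _ p], rule exI[of _ 1]) (simp add: iota_1)

lemma K_0: "0 \<in> K" and K_1: "1 \<in> K"
  using K_iota[of 0] K_iota[of 1] by (simp_all add: iota_1)

lemma K_add: assumes "x \<in> K" "y \<in> K" shows "x + y \<in> K"
proof -
  obtain p q where x: "x = \<iota> p / \<iota> q" "q \<noteq> 0" using assms(1) by (auto simp: K_def)
  obtain p' q' where y: "y = \<iota> p' / \<iota> q'" "q' \<noteq> 0" using assms(2) by (auto simp: K_def)
  have "x + y = \<iota> (p * q' + p' * q) / \<iota> (q * q')"
    using x y by (simp add: iota_add iota_mult field_simps)
  moreover have "q * q' \<noteq> 0" using x y by simp
  ultimately show ?thesis unfolding K_def by blast
qed

lemma K_mult: assumes "x \<in> K" "y \<in> K" shows "x * y \<in> K"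
proof -
  obtain p q where x: "x = \<iota> p / \<iota> q" "q \<noteq> 0" using assms(1) by (auto simp: K_def)
  obtain p' q' where y: "y = \<iota> p' / \<iota> q'" "q' \<noteq> 0" using assms(2) by (auto simp: K_def)
  have "x * y = \<iota> (p * p') / \<iota> (q * q')"
    using x y by (simp add: iota_mult)
  moreover have "q * q' \<noteq> 0" using x y by simp
  ultimately show ?thesis unfolding K_def by blast
qed

lemma K_minus: "x \<in> K \<Longrightarrow> - x \<in> K"
  using K_mult[OF K_iota[of "- 1"], of x] by (simp add: iota_minus iota_1)

lemma K_sum: "(\<And>i. i \<in> A \<Longrightarrow> f i \<in> K) \<Longrightarrow> sum f A \<in> K"
  by (induction A rule: infinite_finite_induct) (auto simp: K_0 K_add)

lemma K_divide_iota: "q \<noteq> 0 \<Longrightarrow> x \<in> K \<Longrightarrow> x / \<iota> q \<in> K"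
proof -
  assume "q \<noteq> 0" "x \<in> K"
  moreover from \<open>q \<noteq> 0\<close> have "\<iota> 1 / \<iota> q \<in> K" unfolding K_def by blast
  ultimately show ?thesis using K_mult[of x "\<iota> 1 / \<iota> q"] by (simp add: iota_1)
qed

lemma d_quotient:
  assumes "q \<noteq> 0"
  shows "d (\<iota> p / \<iota> q) = \<iota> (pderiv p * q - p * pderiv q) / \<iota> (q\<^sup>2)"
proof -
  define x where "x = \<iota> p / \<iota> q"
  have q: "\<iota> q \<noteq> 0" using assms by simp
  then have "\<iota> p = x * \<iota> q" by (simp add: x_def)
  then have "\<iota> (pderiv p) = d x * \<iota> q + x * \<iota> (pderiv q)"
    by (metis d_iota d_mult)
  then have "d x = (\<iota> (pderiv p) - x * \<iota> (pderiv q)) / \<iota> q"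
    using q by (simp add: field_simps)
  also have "\<dots> = \<iota> (pderiv p * q - p * pderiv q) / \<iota> (q\<^sup>2)"
    using q by (simp add: x_def iota_diff iota_mult power2_eq_square field_simps)
  finally show ?thesis by (simp add: x_def)
qed

lemma d_K: "x \<in> K \<Longrightarrow> d x \<in> K"
proof -
  assume "x \<in> K"
  then obtain p q where "x = \<iota> p / \<iota> q" "q \<noteq> 0" by (auto simp: K_def)
  moreover have "q\<^sup>2 \<noteq> 0" using \<open>q \<noteq> 0\<close> by simp
  ultimately show ?thesis using d_quotient[of q p] unfolding K_def by blast
qed

lemma K_lowest_terms:
  assumes "x \<in> K"
  obtains p q where "x = \<iota> p / \<iota> q" "q \<noteq> 0" "\<And>z. poly p z \<noteq> 0 \<or> poly q z \<noteq> 0"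
proof -
  let ?P = "\<lambda>q. q \<noteq> 0 \<and> (\<exists>p. x = \<iota> p / \<iota> q)"
  have "\<exists>q. ?P q" using assms by (auto simp: K_def)
  then obtain q where q: "?P q" "\<And>r. ?P r \<Longrightarrow> degree q \<le> degree r"
    using ex_has_least_nat[of ?P _ degree] by blast
  then obtain p where p: "x = \<iota> p / \<iota> q" by blast
  have "poly p z \<noteq> 0 \<or> poly q z \<noteq> 0" for z
  proof (rule ccontr)
    assume "\<not> ?thesis"
    then obtain p1 q1 where pq: "p = [:- z, 1:] * p1" "q = [:- z, 1:] * q1"
      by (auto simp: poly_eq_0_iff_dvd simp del: mult_pCons_left elim!: dvdE)
    then have "q1 \<noteq> 0" "degree q = Suc (degree q1)"
      using q(1) by (auto simp: degree_mult_eq simp del: mult_pCons_left)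
    moreover have "\<iota> [:- z, 1:] \<noteq> 0" by simp
    then have "x = \<iota> p1 / \<iota> q1"
      unfolding p pq iota_mult by simp
    ultimately show False using q(2)[of q1] by auto
  qed
  with that p q(1) show ?thesis by blast
qed

lemma common_denominator:
  assumes "\<And>i. i < (n::nat) \<Longrightarrow> k i \<in> K"
  shows "\<exists>q c. q \<noteq> 0 \<and> (\<forall>i<n. \<iota> q * k i = \<iota> (c i))"
  using assms
proof (induction n)
  case 0
  show ?case by (intro exI[of _ 1]) simp
next
  case (Suc n)
  then obtain q c where qc: "q \<noteq> 0" "\<And>i. i < n \<Longrightarrow> \<iota> q * k i = \<iota> (c i)"
    by (metis less_SucI)
  obtain p r where pr: "k n = \<iota> p / \<iota> r" "r \<noteq> 0"
    using Suc.prems[of n] by (auto simp: K_def)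
  have "\<iota> (r * q) * k i = \<iota> (if i < n then r * c i else q * p)" if "i < Suc n" for i
    using that qc(2)[of i] pr by (auto simp: iota_mult less_Suc_eq)
  then show ?case
    using qc(1) pr(2)
    by (intro exI[of _ "r * q"] exI[of _ "\<lambda>i. if i < n then r * c i else q * p"]) auto
qed

definition independent :: "nat \<Rightarrow> (nat \<Rightarrow> 'a) \<Rightarrow> bool"
  where "independent n e \<longleftrightarrow>
    (\<forall>i<n. e i \<in> R) \<and> (\<forall>c. (\<Sum>i<n. \<iota> (c i) * e i) = 0 \<longrightarrow> (\<forall>i<n. c i = 0))"

lemma independent_bounded: "\<exists>m. \<forall>n e. independent n e \<longrightarrow> n \<le> m"
proof -
  obtain m where m: "\<And>b :: nat \<Rightarrow> 'a. (\<forall>i. b i \<in> R) \<Longrightarrow>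
      \<exists>Q. (\<exists>i\<le>m. Q i \<noteq> 0) \<and> (\<Sum>i\<le>m. \<iota> (Q i) * b i) = 0"
    using finite_rank by blast
  have "n \<le> m" if ind: "independent n e" for n e
  proof (rule ccontr)
    assume "\<not> n \<le> m"
    define b where "b i = (if i < n then e i else 0)" for i
    have "\<forall>i. b i \<in> R"
      using ind R_0 by (simp add: b_def independent_def)
    then obtain Q where Q: "\<exists>i\<le>m. Q i \<noteq> 0" "(\<Sum>i\<le>m. \<iota> (Q i) * b i) = 0"
      using m by blast
    define c where "c i = (if i \<le> m then Q i else 0)" for i
    have "(\<Sum>i<n. \<iota> (c i) * e i) = (\<Sum>i\<le>m. \<iota> (c i) * e i)"
      using \<open>\<not> n \<le> m\<close> by (intro sum.mono_neutral_right) (auto simp: c_def)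
    also have "\<dots> = (\<Sum>i\<le>m. \<iota> (Q i) * b i)"
      using \<open>\<not> n \<le> m\<close> by (intro sum.cong) (auto simp: c_def b_def)
    finally have c0: "c i = 0" if "i < n" for i
      using that ind Q(2) by (simp add: independent_def)
    obtain i where "i \<le> m" "Q i \<noteq> 0" using Q(1) by blast
    then show False
      using c0[of i] \<open>\<not> n \<le> m\<close> by (simp add: c_def)
  qed
  then show ?thesis by blast
qed

lemma basis_exists:
  "\<exists>n e. n > 0 \<and> independent n e \<and>
    (\<forall>b\<in>R. \<exists>q c. q \<noteq> 0 \<and> \<iota> q * b = (\<Sum>i<n. \<iota> (c i) * e i))"
proof -
  obtain m where m: "\<And>n e. independent n e \<Longrightarrow> n \<le> m"
    using independent_bounded by blast
  let ?P = "\<lambda>n. \<exists>e. independent n e"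
  define n where "n = (GREATEST n. ?P n)"
  have one: "?P 1"
    by (intro exI[of _ "\<lambda>_. 1"]) (simp add: independent_def R_1)
  have "?P n"
    unfolding n_def by (rule GreatestI_nat[of ?P, OF one]) (use m in blast)
  have max: "k \<le> n" if "?P k" for k
    unfolding n_def by (rule Greatest_le_nat[of ?P, OF that]) (use m in blast)
  obtain e where e: "independent n e" using \<open>?P n\<close> by blast
  have "\<exists>q c. q \<noteq> 0 \<and> \<iota> q * b = (\<Sum>i<n. \<iota> (c i) * e i)" if "b \<in> R" for b
  proof -
    have "\<not> independent (Suc n) (e(n := b))"
      using max[of "Suc n"] by auto
    moreover have "\<forall>i<Suc n. (e(n := b)) i \<in> R"
      using e that by (auto simp: independent_def less_Suc_eq)
    ultimately obtain c where c: "(\<Sum>i<Suc n. \<iota> (c i) * (e(n := b)) i) = 0" "\<exists>i<Suc n. c i \<noteq> 0"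
      unfolding independent_def by blast
    have rel: "\<iota> (c n) * b + (\<Sum>i<n. \<iota> (c i) * e i) = 0"
      using c(1) by (simp add: add.commute)
    have "c n \<noteq> 0"
    proof
      assume "c n = 0"
      then have "\<forall>i<n. c i = 0" using rel e by (simp add: independent_def)
      with \<open>c n = 0\<close> c(2) show False by (auto simp: less_Suc_eq)
    qed
    moreover have "\<iota> (c n) * b = (\<Sum>i<n. \<iota> (- c i) * e i)"
      using rel by (simp add: iota_minus sum_negf eq_neg_iff_add_eq_0)
    ultimately show ?thesis by (intro exI[of _ "c n"] exI[of _ "\<lambda>i. - c i"]) simp
  qed
  moreover have "n > 0" using max[OF one] by simp
  ultimately show ?thesis using e by blast
qed

text \<open>
  The lowest nonzero coefficient of an algebraic equation for \<open>b\<close> over \<open>\<complex>[u]\<close> is a multiple of \<open>b\<close>.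
\<close>

lemma divides_a_polynomial:
  assumes "b \<in> R" "b \<noteq> 0"
  shows "\<exists>q g. q \<noteq> 0 \<and> g \<in> R \<and> \<iota> q = b * g"
proof -
  obtain m Q where Q: "\<exists>i\<le>m. Q i \<noteq> 0" "(\<Sum>i\<le>m. \<iota> (Q i) * b ^ i) = 0"
    using finite_rank R_power[OF assms(1)] by metis
  then show ?thesis
  proof (induction m arbitrary: Q)
    case 0
    then show ?case by simp
  next
    case (Suc m)
    define S where "S = (\<Sum>i\<le>m. \<iota> (Q (Suc i)) * b ^ i)"
    have S: "S \<in> R"
      unfolding S_def by (intro R_sum R_mult iota_in_R R_power assms)
    have "(\<Sum>i\<le>m. \<iota> (Q (Suc i)) * b ^ Suc i) = b * S"
      unfolding S_def sum_distrib_left by (intro sum.cong) (auto simp: mult_ac)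
    then have eq: "\<iota> (Q 0) + b * S = 0"
      using Suc.prems(2) by (subst (asm) sum.atMost_Suc_shift) simp
    show ?case
    proof (cases "Q 0 = 0")
      case True
      then have "S = 0" using eq assms by simp
      moreover have "\<exists>i\<le>m. Q (Suc i) \<noteq> 0"
        using Suc.prems(1) True by (metis Suc_le_mono not0_implies_Suc)
      ultimately show ?thesis
        using Suc.IH[of "\<lambda>i. Q (Suc i)"] by (simp add: S_def)
    next
      case False
      moreover have "\<iota> (Q 0) = b * (- S)" using eq by (simp add: eq_neg_iff_add_eq_0)
      ultimately show ?thesis using R_minus[OF S] by blast
    qed
  qed
qed

text \<open>
  A submodule of a free module of rank \<open>n\<close> over the principal ideal domain \<open>\<complex>[u]\<close> is finitely generated:
  one generator produces the ideal of values of the last coordinate, and the kernel of that coordinate is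
  covered by induction.
\<close>

lemma finitely_generated_if_functionals_separate:
  fixes \<phi> :: "nat \<Rightarrow> 'a \<Rightarrow> complex poly"
  assumes "0 \<in> M" "\<And>x y. x \<in> M \<Longrightarrow> y \<in> M \<Longrightarrow> x + y \<in> M" "\<And>p x. x \<in> M \<Longrightarrow> \<iota> p * x \<in> M"
    and "\<And>i x y. i < n \<Longrightarrow> x \<in> M \<Longrightarrow> y \<in> M \<Longrightarrow> \<phi> i (x + y) = \<phi> i x + \<phi> i y"
    and "\<And>i p x. i < n \<Longrightarrow> x \<in> M \<Longrightarrow> \<phi> i (\<iota> p * x) = p * \<phi> i x"
    and "\<And>x. x \<in> M \<Longrightarrow> (\<forall>i<n. \<phi> i x = 0) \<Longrightarrow> x = 0"
  shows "\<exists>(m::nat) g. (\<forall>i<m. g i \<in> M) \<and> (\<forall>x\<in>M. \<exists>c. x = (\<Sum>i<m. \<iota> (c i) * g i))"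
  using assms
proof (induction n arbitrary: M)
  case 0
  then have "M = {0}" by auto
  then show ?case by (intro exI[of _ 0]) auto
next
  case (Suc n)
  define M0 where "M0 = {x \<in> M. \<phi> n x = 0}"
  have phi0: "\<phi> i 0 = 0" if "i < Suc n" for i
    using Suc.prems(4)[OF that Suc.prems(1) Suc.prems(1)] by simp
  have "\<exists>(m::nat) g. (\<forall>i<m. g i \<in> M0) \<and> (\<forall>x\<in>M0. \<exists>c. x = (\<Sum>i<m. \<iota> (c i) * g i))"
  proof (rule Suc.IH)
    show "0 \<in> M0" using Suc.prems(1) phi0 by (simp add: M0_def)
    show "x = 0" if "x \<in> M0" "\<forall>i<n. \<phi> i x = 0" for x
      using that Suc.prems(6)[of x] by (auto simp: M0_def less_Suc_eq)
  qed (use Suc.prems in \<open>auto simp: M0_def\<close>)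
  then obtain m :: nat and g where g: "\<And>i. i < m \<Longrightarrow> g i \<in> M0" "\<And>x. x \<in> M0 \<Longrightarrow> \<exists>c. x = (\<Sum>i<m. \<iota> (c i) * g i)"
    by blast
  show ?case
  proof (cases "\<forall>x\<in>M. \<phi> n x = 0")
    case True
    then have "M0 = M" by (auto simp: M0_def)
    with g show ?thesis by blast
  next
    case False
    then have "\<exists>x. x \<in> M \<and> \<phi> n x \<noteq> 0" by blast
    then obtain h where h: "h \<in> M" "\<phi> n h \<noteq> 0"
      and hmin: "\<And>x. x \<in> M \<and> \<phi> n x \<noteq> 0 \<Longrightarrow> degree (\<phi> n h) \<le> degree (\<phi> n x)"
      using ex_has_least_nat[of "\<lambda>x. x \<in> M \<and> \<phi> n x \<noteq> 0" _ "\<lambda>x. degree (\<phi> n x)"] by blast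
    have "\<exists>c. x = (\<Sum>i<Suc m. \<iota> (c i) * (g(m := h)) i)" if x: "x \<in> M" for x
    proof -
      define q where "q = \<phi> n x div \<phi> n h"
      define y where "y = x + \<iota> (- q) * h"
      have y: "y \<in> M"
        unfolding y_def by (intro Suc.prems(2,3) x h)
      have "\<phi> n y = \<phi> n x mod \<phi> n h"
        using Suc.prems(4)[of n x "\<iota> (- q) * h"] Suc.prems(3,5) x h
        by (simp add: y_def q_def minus_div_mult_eq_mod)
      then have "\<phi> n y = 0"
        using hmin[of y] y h(2) degree_mod_less'[of "\<phi> n h" "\<phi> n x"] by fastforce
      then obtain c where c: "y = (\<Sum>i<m. \<iota> (c i) * g i)"
        using g(2)[of y] y by (auto simp: M0_def)
      have "(\<Sum>i<Suc m. \<iota> ((c(m := q)) i) * (g(m := h)) i) = y + \<iota> q * h"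
        by (simp add: c)
      also have "\<dots> = x" by (simp add: y_def iota_minus)
      finally show ?thesis by metis
    qed
    moreover have "\<forall>i<Suc m. (g(m := h)) i \<in> M"
      using g(1) h(1) by (auto simp: M0_def less_Suc_eq)
    ultimately show ?thesis by blast
  qed
qed

end

locale differential_ring_basis = surjective_differential_ring +
  fixes n :: nat and e :: "nat \<Rightarrow> 'a"
  assumes n_pos: "n > 0" and e_independent: "independent n e"
    and e_span: "b \<in> R \<Longrightarrow> \<exists>q c. q \<noteq> 0 \<and> \<iota> q * b = (\<Sum>i<n. \<iota> (c i) * e i)"
begin

lemma e_R: "i < n \<Longrightarrow> e i \<in> R"
  using e_independent by (simp add: independent_def)

text \<open>
  The \<open>\<complex>(u)\<close>-span of the basis, which is the field of fractions of \<open>R\<close>.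
\<close>

definition V :: "'a set"
  where "V = {b. \<exists>k. (\<forall>i<n. k i \<in> K) \<and> b = (\<Sum>i<n. k i * e i)}"

definition coord :: "'a \<Rightarrow> nat \<Rightarrow> 'a"
  where "coord b = (SOME k. (\<forall>i<n. k i \<in> K) \<and> b = (\<Sum>i<n. k i * e i))"

lemma coord_K: "b \<in> V \<Longrightarrow> i < n \<Longrightarrow> coord b i \<in> K"
  and coord_sum: "b \<in> V \<Longrightarrow> b = (\<Sum>i<n. coord b i * e i)"
proof -
  assume "b \<in> V"
  then have "(\<forall>i<n. coord b i \<in> K) \<and> b = (\<Sum>i<n. coord b i * e i)"
    unfolding coord_def V_def mem_Collect_eq by (rule someI_ex)
  then show "i < n \<Longrightarrow> coord b i \<in> K" "b = (\<Sum>i<n. coord b i * e i)" by auto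
qed

lemma K_independent:
  assumes "\<And>i. i < n \<Longrightarrow> k i \<in> K" "(\<Sum>i<n. k i * e i) = 0" "i < n"
  shows "k i = 0"
proof -
  obtain q c where qc: "q \<noteq> 0" "\<And>i. i < n \<Longrightarrow> \<iota> q * k i = \<iota> (c i)"
    using common_denominator[of n k] assms(1) by blast
  have "(\<Sum>i<n. \<iota> (c i) * e i) = \<iota> q * (\<Sum>i<n. k i * e i)"
    unfolding sum_distrib_left by (intro sum.cong) (simp_all add: mult.assoc flip: qc(2))
  then have "c i = 0"
    using assms(2,3) e_independent by (simp add: independent_def)
  with qc(2)[OF assms(3)] qc(1) show ?thesis by simp
qed

lemma coordI:
  assumes "\<And>i. i < n \<Longrightarrow> k i \<in> K" "b = (\<Sum>i<n. k i * e i)" "i < n"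
  shows "coord b i = k i"
proof -
  have V: "b \<in> V" using assms(1,2) by (auto simp: V_def)
  have "(\<Sum>i<n. (coord b i + - k i) * e i) = 0"
    using coord_sum[OF V] assms(2) by (simp add: left_diff_distrib sum_subtractf)
  then have "coord b i + - k i = 0"
    using K_independent[of "\<lambda>i. coord b i + - k i" i] assms(1,3) coord_K[OF V] K_add K_minus
    by blast
  then show ?thesis by simp
qed

lemma R_subset_V: "b \<in> R \<Longrightarrow> b \<in> V"
proof -
  assume "b \<in> R"
  then obtain q c where qc: "q \<noteq> 0" "\<iota> q * b = (\<Sum>i<n. \<iota> (c i) * e i)"
    using e_span by blast
  have "b = (\<Sum>i<n. (\<iota> (c i) / \<iota> q) * e i)"
    using qc by (simp add: field_simps flip: sum_divide_distrib)
  moreover have "\<iota> (c i) / \<iota> q \<in> K" for i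
    using qc(1) by (intro K_divide_iota K_iota)
  ultimately show ?thesis
    unfolding V_def by (intro CollectI exI[of _ "\<lambda>i. \<iota> (c i) / \<iota> q"]) simp
qed

lemma coord_add:
  assumes "a \<in> V" "b \<in> V" "i < n"
  shows "coord (a + b) i = coord a i + coord b i"
proof (rule coordI[OF _ _ assms(3)])
  show "a + b = (\<Sum>i<n. (coord a i + coord b i) * e i)"
    using coord_sum[OF assms(1)] coord_sum[OF assms(2)] by (simp add: distrib_right sum.distrib)
qed (use assms coord_K K_add in auto)

lemma coord_scale:
  assumes "k \<in> K" "b \<in> V" "i < n"
  shows "coord (k * b) i = k * coord b i"
proof (rule coordI[OF _ _ assms(3)])
  have "k * b = k * (\<Sum>i<n. coord b i * e i)"
    using coord_sum[OF assms(2)] by simp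
  then show "k * b = (\<Sum>i<n. (k * coord b i) * e i)"
    by (simp add: sum_distrib_left mult.assoc)
qed (use assms coord_K K_mult in auto)

lemma coord_linear_combination:
  assumes "\<And>l. l < n \<Longrightarrow> k l \<in> K" "\<And>l. l < n \<Longrightarrow> x l \<in> V" "i < n"
  shows "coord (\<Sum>l<n. k l * x l) i = (\<Sum>l<n. k l * coord (x l) i)"
proof (rule coordI[OF _ _ assms(3)])
  have "(\<Sum>l<n. k l * x l) = (\<Sum>l<n. k l * (\<Sum>i<n. coord (x l) i * e i))"
    using coord_sum[OF assms(2)] by (intro sum.cong refl) auto
  also have "\<dots> = (\<Sum>l<n. \<Sum>i<n. (k l * coord (x l) i) * e i)"
    by (simp add: sum_distrib_left mult.assoc)
  also have "\<dots> = (\<Sum>i<n. \<Sum>l<n. (k l * coord (x l) i) * e i)"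
    by (rule sum.swap)
  finally show "(\<Sum>l<n. k l * x l) = (\<Sum>i<n. (\<Sum>l<n. k l * coord (x l) i) * e i)"
    by (simp add: sum_distrib_right)
qed (use assms coord_K in \<open>auto intro!: K_sum K_mult\<close>)

definition A :: "nat \<Rightarrow> nat \<Rightarrow> 'a"
  where "A i j = coord (d (e i)) j"

lemma d_e: "i < n \<Longrightarrow> d (e i) = (\<Sum>j<n. A i j * e j)"
  using coord_sum[of "d (e i)"] R_subset_V d_R e_R by (simp add: A_def)

lemma A_K: "i < n \<Longrightarrow> j < n \<Longrightarrow> A i j \<in> K"
  using coord_K[of "d (e i)" j] R_subset_V d_R e_R by (simp add: A_def)

lemma coord_d:
  assumes "b \<in> V" "j < n"
  shows "coord (d b) j = d (coord b j) + (\<Sum>i<n. coord b i * A i j)"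
proof (rule coordI[OF _ _ assms(2)])
  have "d b = d (\<Sum>i<n. coord b i * e i)"
    using coord_sum[OF assms(1)] by simp
  also have "\<dots> = (\<Sum>i<n. d (coord b i) * e i) + (\<Sum>i<n. coord b i * (\<Sum>j<n. A i j * e j))"
    by (simp add: d_sum d_mult sum.distrib d_e)
  also have "(\<Sum>i<n. coord b i * (\<Sum>j<n. A i j * e j)) = (\<Sum>i<n. \<Sum>j<n. coord b i * A i j * e j)"
    by (simp add: sum_distrib_left mult.assoc)
  also have "\<dots> = (\<Sum>j<n. \<Sum>i<n. coord b i * A i j * e j)"
    by (rule sum.swap)
  finally show "d b = (\<Sum>j<n. (d (coord b j) + (\<Sum>i<n. coord b i * A i j)) * e j)"
    by (simp add: sum.distrib distrib_right sum_distrib_right)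
qed (use assms coord_K A_K d_K in \<open>auto intro!: K_sum K_mult K_add\<close>)

text \<open>
  The trace over \<open>\<complex>(u)\<close> of multiplication by \<open>b\<close>.
\<close>

definition trace :: "'a \<Rightarrow> 'a"
  where "trace b = (\<Sum>i<n. coord (b * e i) i)"

lemma mult_e_V: "b \<in> R \<Longrightarrow> i < n \<Longrightarrow> b * e i \<in> V"
  by (intro R_subset_V R_mult e_R)

lemma trace_K: "b \<in> R \<Longrightarrow> trace b \<in> K"
  unfolding trace_def by (intro K_sum coord_K mult_e_V) auto

lemma trace_add: "a \<in> R \<Longrightarrow> b \<in> R \<Longrightarrow> trace (a + b) = trace a + trace b"
  by (simp add: trace_def distrib_right coord_add mult_e_V sum.distrib)

lemma trace_iota: "b \<in> R \<Longrightarrow> trace (\<iota> p * b) = \<iota> p * trace b"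
  by (simp add: trace_def mult.assoc coord_scale K_iota mult_e_V sum_distrib_left)

lemma trace_0: "trace 0 = 0"
  using trace_add[OF R_0 R_0] by (metis add.right_neutral add_left_cancel)

lemma trace_sum: "(\<And>i. i \<in> I \<Longrightarrow> f i \<in> R) \<Longrightarrow> trace (sum f I) = (\<Sum>i\<in>I. trace (f i))"
  by (induction I rule: infinite_finite_induct) (auto simp: trace_0 trace_add R_sum)

lemma trace_1: "trace 1 = of_nat n"
proof -
  have "coord (e i) i = 1" if "i < n" for i
  proof -
    have "coord (e i) i = (if i = i then 1 else 0)"
    proof (rule coordI[where k = "\<lambda>j. if j = i then 1 else 0", OF _ _ that])
      show "e i = (\<Sum>j<n. (if j = i then 1 else 0) * e j)"
        using that by (simp add: if_distrib[of "\<lambda>x. x * _"] cong: if_cong)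
    qed (auto simp: K_0 K_1)
    then show ?thesis by simp
  qed
  then show ?thesis by (simp add: trace_def)
qed

text \<open>
  If \<open>M\<close> is the matrix of multiplication by \<open>b\<close> and \<open>A\<close> that of \<open>d\<close> on the basis, multiplication by \<open>d b\<close>
  has the matrix \<open>M' + M A - A M\<close>, and commutators have trace zero.
\<close>

lemma trace_d:
  assumes b: "b \<in> R"
  shows "trace (d b) = d (trace b)"
proof -
  have main: "coord (d b * e i) i = d (coord (b * e i) i)
      + (\<Sum>l<n. coord (b * e i) l * A l i) - (\<Sum>l<n. A i l * coord (b * e l) i)" if i: "i < n" for i
  proof -
    have "coord (d (b * e i)) i = coord (d b * e i + b * d (e i)) i"
      by (simp add: d_mult)
    also have "\<dots> = coord (d b * e i) i + coord (b * d (e i)) i"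
      using i b by (intro coord_add mult_e_V R_subset_V R_mult d_R e_R) auto
    also have "b * d (e i) = (\<Sum>l<n. A i l * (b * e l))"
      by (simp add: d_e[OF i] sum_distrib_left mult_ac)
    also have "coord \<dots> i = (\<Sum>l<n. A i l * coord (b * e l) i)"
      using i b by (intro coord_linear_combination A_K mult_e_V) auto
    finally show ?thesis
      using coord_d[OF mult_e_V[OF b i] i] by simp
  qed
  have "(\<Sum>i<n. \<Sum>l<n. coord (b * e i) l * A l i) = (\<Sum>l<n. \<Sum>i<n. coord (b * e i) l * A l i)"
    by (rule sum.swap)
  also have "\<dots> = (\<Sum>i<n. \<Sum>l<n. A i l * coord (b * e l) i)"
    by (simp add: mult.commute)
  finally have swap: "(\<Sum>i<n. \<Sum>l<n. coord (b * e i) l * A l i)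
      = (\<Sum>i<n. \<Sum>l<n. A i l * coord (b * e l) i)" .
  have "trace (d b) = (\<Sum>i<n. d (coord (b * e i) i)
      + (\<Sum>l<n. coord (b * e i) l * A l i) - (\<Sum>l<n. A i l * coord (b * e l) i))"
    unfolding trace_def using main by (intro sum.cong) auto
  also have "\<dots> = (\<Sum>i<n. d (coord (b * e i) i))"
    by (simp add: sum.distrib sum_subtractf swap)
  finally show ?thesis by (simp add: trace_def d_sum)
qed

text \<open>
  If the trace of \<open>b\<close> had a pole at \<open>z\<close>, a polynomial multiple of \<open>b\<close> would have a trace with a simple pole
  at \<open>z\<close>. But that multiple has a primitive \<open>a\<close> in \<open>R\<close>, and the trace of \<open>a\<close> would be a rational primitive.
\<close>

lemma trace_polynomial:
  assumes "b \<in> R"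
  shows "\<exists>p. trace b = \<iota> p"
proof -
  obtain p q where pq: "trace b = \<iota> p / \<iota> q" "q \<noteq> 0" "\<And>z. poly p z \<noteq> 0 \<or> poly q z \<noteq> 0"
    using K_lowest_terms[OF trace_K[OF assms]] by blast
  have "degree q = 0"
  proof (rule ccontr)
    assume "degree q \<noteq> 0"
    then obtain z where z: "poly q z = 0"
      using Fundamental_Theorem_Algebra.fundamental_theorem_of_algebra[of q] by (auto simp: constant_degree)
    define l where "l = [:- z, 1:]"
    obtain q1 where q1: "q = l * q1"
      using z by (auto simp: l_def poly_eq_0_iff_dvd simp del: mult_pCons_left elim!: dvdE)
    then have "q1 \<noteq> 0" using pq(2) by auto
    have "l \<noteq> 0" by (simp add: l_def)
    have q1b: "\<iota> q1 * b \<in> R" by (intro R_mult iota_in_R assms)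
    then obtain a where a: "a \<in> R" "d a = \<iota> q1 * b"
      using R_primitive by blast
    obtain \<alpha> \<beta> where \<alpha>\<beta>: "trace a = \<iota> \<alpha> / \<iota> \<beta>" "\<beta> \<noteq> 0" "\<And>z. poly \<alpha> z \<noteq> 0 \<or> poly \<beta> z \<noteq> 0"
      using K_lowest_terms[OF trace_K[OF a(1)]] by blast
    have "\<iota> p / \<iota> l = trace (\<iota> q1 * b)"
      using \<open>q1 \<noteq> 0\<close> assms by (simp add: trace_iota pq(1) q1 iota_mult)
    also have "\<dots> = d (trace a)"
      using trace_d[OF a(1)] a(2) by simp
    also have "\<dots> = \<iota> (pderiv \<alpha> * \<beta> - \<alpha> * pderiv \<beta>) / \<iota> (\<beta>\<^sup>2)"
      unfolding \<alpha>\<beta>(1) by (rule d_quotient[OF \<alpha>\<beta>(2)])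
    finally have "\<iota> (pderiv \<alpha> * \<beta> - \<alpha> * pderiv \<beta>) * \<iota> l = \<iota> p * \<iota> (\<beta>\<^sup>2)"
      using \<open>l \<noteq> 0\<close> \<alpha>\<beta>(2) by (simp add: frac_eq_eq iota_power)
    then have "\<iota> ((pderiv \<alpha> * \<beta> - \<alpha> * pderiv \<beta>) * l - p * \<beta>\<^sup>2) = 0"
      by (simp only: iota_mult iota_diff) simp
    then have "(pderiv \<alpha> * \<beta> - \<alpha> * pderiv \<beta>) * [:- z, 1:] = p * \<beta>\<^sup>2"
      unfolding iota_eq_0 l_def by simp
    then have "poly p z = 0"
      using derivative_no_simple_pole \<alpha>\<beta>(2,3) by blast
    with z pq(3) show False by blast
  qed
  then obtain c where c: "q = [:c:]" by (metis degree_eq_zeroE)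
  with pq(2) have "c \<noteq> 0" by auto
  then have "p = q * smult (inverse c) p" by (simp add: c)
  then have "trace b = \<iota> (smult (inverse c) p)"
    using pq(1,2) by (metis iota_eq_0 iota_mult nonzero_mult_div_cancel_left)
  then show ?thesis by blast
qed

text \<open>
  Otherwise the trace would vanish on \<open>b R\<close>, which contains a nonzero polynomial \<open>q\<close>; but the trace of \<open>q\<close>
  is \<open>n q\<close>.
\<close>

lemma trace_form_nondegenerate:
  assumes b: "b \<in> R" and zero: "\<And>i. i < n \<Longrightarrow> trace (b * e i) = 0"
  shows "b = 0"
proof (rule ccontr)
  assume "b \<noteq> 0"
  then obtain q g where qg: "q \<noteq> 0" "g \<in> R" "\<iota> q = b * g"
    using divides_a_polynomial[OF b] by blast
  obtain r c where rc: "r \<noteq> 0" "\<iota> r * g = (\<Sum>i<n. \<iota> (c i) * e i)"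
    using e_span[OF qg(2)] by blast
  have "\<iota> r * \<iota> q = b * (\<Sum>i<n. \<iota> (c i) * e i)"
    by (metis qg(3) mult.left_commute rc(2))
  also have "\<dots> = (\<Sum>i<n. \<iota> (c i) * (b * e i))"
    by (simp add: sum_distrib_left mult_ac)
  also have "trace \<dots> = (\<Sum>i<n. \<iota> (c i) * trace (b * e i))"
    using b e_R by (subst trace_sum) (auto simp: trace_iota R_mult iota_in_R)
  also have "\<dots> = 0" using zero by simp
  finally have "trace (\<iota> (r * q) * 1) = 0" by (simp add: iota_mult)
  then have "\<iota> (r * q * of_nat n) = 0"
    unfolding trace_iota[OF R_1] trace_1 iota_mult[of _ "of_nat n"] iota_of_nat .
  with rc(1) qg(1) n_pos show False
    unfolding iota_eq_0 by simp
qed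

lemma finitely_generated_by_trace:
  "\<exists>(m::nat) g. (\<forall>i<m. g i \<in> R) \<and> (\<forall>x\<in>R. \<exists>c. x = (\<Sum>i<m. \<iota> (c i) * g i))"
proof -
  define \<phi> where "\<phi> i b = (SOME p. trace (b * e i) = \<iota> p)" for i b
  have phi: "\<iota> (\<phi> i b) = trace (b * e i)" if "b \<in> R" "i < n" for i b
    unfolding \<phi>_def using someI_ex[OF trace_polynomial[OF R_mult[OF that(1) e_R[OF that(2)]]]] by simp
  have inj: "p = q" if "\<iota> p = \<iota> q" for p q
    using that iota_eq_0[of "p - q"] by (simp add: iota_diff)
  show ?thesis
  proof (rule finitely_generated_if_functionals_separate[of R n \<phi>])
    fix i x y assume *: "i < n" "x \<in> R" "y \<in> R"
    then show "\<phi> i (x + y) = \<phi> i x + \<phi> i y"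
      by (intro inj) (simp add: phi iota_add R_add distrib_right trace_add R_mult e_R)
  next
    fix i p x assume *: "i < n" "x \<in> R"
    then show "\<phi> i (\<iota> p * x) = p * \<phi> i x"
      by (intro inj) (simp add: phi iota_mult R_mult iota_in_R mult.assoc trace_iota e_R)
  next
    fix x assume x: "x \<in> R" "\<forall>i<n. \<phi> i x = 0"
    then have "trace (x * e i) = 0" if "i < n" for i
      using phi[OF x(1) that] that by simp
    then show "x = 0" using trace_form_nondegenerate[OF x(1)] by blast
  qed (auto simp: R_0 R_add R_mult iota_in_R)
qed

end

theorem (in surjective_differential_ring) finitely_generated:
  "\<exists>(m::nat) g. (\<forall>i<m. g i \<in> R) \<and> (\<forall>x\<in>R. \<exists>c. x = (\<Sum>i<m. \<iota> (c i) * g i))"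
proof -
  obtain n e where "n > 0" "independent n e"
      "\<forall>b\<in>R. \<exists>q c. q \<noteq> 0 \<and> \<iota> q * b = (\<Sum>i<n. \<iota> (c i) * e i)"
    using basis_exists by blast
  then interpret differential_ring_basis \<iota> d R n e
    by unfold_locales auto
  show ?thesis by (rule finitely_generated_by_trace)
qed

section \<open>Linear differential equations with polynomial coefficients\<close>

text \<open>
  The differential equation expresses the coefficient of \<open>u\<^sup>k\<^sup>+\<^sup>1\<close> through boundedly many earlier ones, divided
  by \<open>k + 1\<close>. For each radius \<open>r\<close> this division eventually outweighs the size of the polynomial
  coefficients, so the rescaled coefficients \<open>t k\<close> stay bounded.
\<close>

lemma linear_ode_entire:
  fixes g :: "nat \<Rightarrow> complex fps" and A :: "nat \<Rightarrow> nat \<Rightarrow> complex poly"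
  assumes ode: "\<And>i. i < m \<Longrightarrow> fps_deriv (g i) = (\<Sum>j<m. fps_of_poly (A i j) * g j)"
    and i: "i < m"
  shows "fps_conv_radius (g i) = \<infinity>"
proof -
  define d where "d = (\<Sum>i<m. \<Sum>j<m. degree (A i j))"
  have d: "degree (A i j) \<le> d" if "i < m" "j < m" for i j
  proof -
    have "degree (A i j) \<le> (\<Sum>j<m. degree (A i j))"
      using that by (intro member_le_sum) auto
    also have "\<dots> \<le> d"
      unfolding d_def using that by (intro member_le_sum) auto
    finally show ?thesis .
  qed
  have bounded: "\<exists>B. \<forall>k. (\<Sum>i<m. norm (g i $ k)) * r ^ k \<le> B" if r: "r > 0" for r :: real
  proof -
    define t where "t k = (\<Sum>i<m. norm (g i $ k)) * r ^ k" for k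
    \<comment> \<open>The equation bounds \<open>(k + 1) t (k + 1)\<close> by \<open>\<beta>\<close> times the maximum of the previous \<open>t j\<close>.\<close>
    define \<beta> where "\<beta> = (\<Sum>i<m. \<Sum>j<m. \<Sum>l\<le>d. norm (coeff (A i j) l) * r ^ Suc l)"
    have t_nonneg: "t k \<ge> 0" for k
      using r by (simp add: t_def sum_nonneg)
    have term_le: "norm (g i $ k) * r ^ k \<le> t k" if "i < m" for i k
      unfolding t_def sum_distrib_right using that r by (intro member_le_sum) auto
    have step: "real (Suc k) * t (Suc k) \<le> \<beta> * B" if B: "\<And>j. j \<le> k \<Longrightarrow> t j \<le> B" for k B
    proof -
      have B0: "B \<ge> 0" using B[of 0] t_nonneg[of 0] by simp
      have one: "real (Suc k) * norm (g i $ Suc k) * r ^ Suc k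
          \<le> (\<Sum>j<m. \<Sum>l\<le>d. norm (coeff (A i j) l) * r ^ Suc l * B)" if i: "i < m" for i
      proof -
        have "of_nat (Suc k) * g i $ Suc k = fps_deriv (g i) $ k"
          by simp
        also have "\<dots> = (\<Sum>j<m. \<Sum>l\<le>k. coeff (A i j) l * g j $ (k - l))"
          by (simp add: ode[OF i] fps_sum_nth fps_mult_nth atLeast0AtMost)
        finally have "real (Suc k) * norm (g i $ Suc k)
            = norm (\<Sum>j<m. \<Sum>l\<le>k. coeff (A i j) l * g j $ (k - l))"
          by (metis norm_mult norm_of_nat)
        also have "\<dots> \<le> (\<Sum>j<m. \<Sum>l\<le>k. norm (coeff (A i j) l) * norm (g j $ (k - l)))"
          by (intro order_trans[OF norm_sum] sum_mono order_trans[OF norm_sum]) (simp add: norm_mult)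
        finally have "real (Suc k) * norm (g i $ Suc k) * r ^ Suc k
            \<le> (\<Sum>j<m. \<Sum>l\<le>k. norm (coeff (A i j) l) * norm (g j $ (k - l))) * r ^ Suc k"
          using r by (intro mult_right_mono) auto
        also have "\<dots> = (\<Sum>j<m. \<Sum>l\<le>k. norm (coeff (A i j) l) * r ^ Suc l
            * (norm (g j $ (k - l)) * r ^ (k - l)))"
        proof -
          have "norm (coeff (A i j) l) * norm (g j $ (k - l)) * r ^ Suc k
              = norm (coeff (A i j) l) * r ^ Suc l * (norm (g j $ (k - l)) * r ^ (k - l))"
            if "l \<le> k" for j l
          proof -
            have "r ^ Suc k = r ^ Suc l * r ^ (k - l)"
              using that by (simp flip: power_add)
            then show ?thesis by simp
          qed
          then show ?thesis
            unfolding sum_distrib_right by (intro sum.cong refl) auto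
        qed
        also have "\<dots> \<le> (\<Sum>j<m. \<Sum>l\<le>k. norm (coeff (A i j) l) * r ^ Suc l * B)"
          using r B by (intro sum_mono mult_left_mono order_trans[OF term_le]) auto
        also have "\<dots> \<le> (\<Sum>j<m. \<Sum>l\<le>d. norm (coeff (A i j) l) * r ^ Suc l * B)"
        proof (intro sum_mono)
          fix j assume j: "j \<in> {..<m}"
          have "(\<Sum>l\<le>k. norm (coeff (A i j) l) * r ^ Suc l * B)
              = (\<Sum>l\<in>{..k} \<inter> {..d}. norm (coeff (A i j) l) * r ^ Suc l * B)"
            using d[OF i, of j] j by (intro sum.mono_neutral_right) (auto simp: coeff_eq_0 not_le)
          also have "\<dots> \<le> (\<Sum>l\<le>d. norm (coeff (A i j) l) * r ^ Suc l * B)"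
            using r B0 by (intro sum_mono2) auto
          finally show "(\<Sum>l\<le>k. norm (coeff (A i j) l) * r ^ Suc l * B)
              \<le> (\<Sum>l\<le>d. norm (coeff (A i j) l) * r ^ Suc l * B)" .
        qed
        finally show ?thesis .
      qed
      have "real (Suc k) * t (Suc k) = (\<Sum>i<m. real (Suc k) * norm (g i $ Suc k) * r ^ Suc k)"
        by (simp only: t_def sum_distrib_left sum_distrib_right mult.assoc)
      also have "\<dots> \<le> (\<Sum>i<m. \<Sum>j<m. \<Sum>l\<le>d. norm (coeff (A i j) l) * r ^ Suc l * B)"
        by (intro sum_mono one) auto
      also have "\<dots> = \<beta> * B"
        by (simp only: \<beta>_def sum_distrib_right)
      finally show ?thesis .
    qed
    define N where "N = nat \<lceil>\<beta>\<rceil>"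
    define B where "B = (\<Sum>j\<le>N. t j)"
    have "B \<ge> 0" unfolding B_def by (intro sum_nonneg t_nonneg)
    have "t k \<le> B" for k
    proof (induction k rule: less_induct)
      case (less k)
      show ?case
      proof (cases "k \<le> N")
        case True
        then show ?thesis
          unfolding B_def using t_nonneg by (intro member_le_sum) auto
      next
        case False
        then obtain k' where k': "k = Suc k'" by (cases k) auto
        have "real (Suc k') * t (Suc k') \<le> \<beta> * B"
          using less.IH k' by (intro step) auto
        also have "\<dots> \<le> real (Suc k') * B"
          using False \<open>B \<ge> 0\<close> unfolding k' N_def by (intro mult_right_mono) linarith+
        finally show ?thesis unfolding k' by simp
      qed
    qed
    then show ?thesis unfolding t_def by blast
  qed
  have "fps_conv_radius (g i) \<ge> \<infinity>"
    unfolding fps_conv_radius_def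
  proof (rule conv_radius_geI_ex')
    fix r :: real assume r: "0 < r"
    \<comment> \<open>Boundedness at the radius \<open>2 r\<close> gives a geometric majorant at the radius \<open>r\<close>.\<close>
    obtain B where B: "\<And>k. (\<Sum>i<m. norm (g i $ k)) * (2 * r) ^ k \<le> B"
      using bounded[of "2 * r"] r by auto
    have "norm (g i $ k * complex_of_real r ^ k) \<le> B * (1 / 2) ^ k" for k
    proof -
      have "norm (g i $ k) * (2 * r) ^ k \<le> (\<Sum>i<m. norm (g i $ k)) * (2 * r) ^ k"
        using i r by (intro mult_right_mono member_le_sum) auto
      also have "\<dots> \<le> B" by (rule B)
      finally show ?thesis
        using r by (simp add: norm_mult norm_power power_mult_distrib field_simps)
    qed
    then show "summable (\<lambda>k. g i $ k * complex_of_real r ^ k)"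
      by (intro summable_comparison_test'[OF summable_mult[OF summable_geometric]]) auto
  qed
  then show ?thesis by simp
qed

section \<open>Entire power series of polynomial growth\<close>

lemma entire_mult:
  fixes f g :: "complex fps"
  shows "fps_conv_radius f = \<infinity> \<Longrightarrow> fps_conv_radius g = \<infinity> \<Longrightarrow> fps_conv_radius (f * g) = \<infinity>"
  using fps_conv_radius_mult[of f g] by simp

lemma entire_sum:
  fixes f :: "'i \<Rightarrow> complex fps"
  shows "(\<And>i. i \<in> I \<Longrightarrow> fps_conv_radius (f i) = \<infinity>) \<Longrightarrow> fps_conv_radius (sum f I) = \<infinity>"
proof (induction I rule: infinite_finite_induct)
  case (insert i I)
  then show ?case using fps_conv_radius_add[of "f i" "sum f I"] by simp
qed simp_all

lemma eval_fps_sum: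
  fixes f :: "'i \<Rightarrow> complex fps"
  shows "(\<And>i. i \<in> I \<Longrightarrow> fps_conv_radius (f i) = \<infinity>) \<Longrightarrow> eval_fps (sum f I) z = (\<Sum>i\<in>I. eval_fps (f i) z)"
proof (induction I rule: infinite_finite_induct)
  case (insert i I)
  then show ?case by (simp add: eval_fps_add entire_sum)
qed simp_all

lemma poly_norm_bound:
  fixes p :: "complex poly"
  assumes "norm z \<ge> 1" "degree p \<le> N"
  shows "norm (poly p z) \<le> (\<Sum>k\<le>degree p. norm (coeff p k)) * norm z ^ N"
proof -
  have "norm (poly p z) \<le> (\<Sum>k\<le>degree p. norm (coeff p k) * norm z ^ k)"
    unfolding poly_altdef by (rule order_trans[OF norm_sum]) (simp add: norm_mult norm_power)
  also have "\<dots> \<le> (\<Sum>k\<le>degree p. norm (coeff p k) * norm z ^ N)"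
    using assms by (intro sum_mono mult_left_mono power_increasing) auto
  finally show ?thesis by (simp add: sum_distrib_right)
qed

lemma entire_polynomial_growth_imp_polynomial:
  fixes f :: "complex fps"
  assumes "fps_conv_radius f = \<infinity>" "\<And>z. 1 \<le> norm z \<Longrightarrow> norm (eval_fps f z) \<le> C * norm z ^ N"
  shows "\<exists>p. f = fps_of_poly p"
proof -
  define p where "p = (\<Sum>k\<le>N. monom ((deriv ^^ k) (eval_fps f) 0 / fact k) k)"
  have "eval_fps f holomorphic_on UNIV"
    using assms(1) by (intro holomorphic_on_eval_fps) simp
  from Liouville_polynomial[OF this assms(2)]
  have "eval_fps f z = poly p z" for z
    by (simp add: p_def poly_sum poly_monom)
  then have "f = fps_of_poly p"
    using assms(1) by (intro eval_fps_eqD) simp_all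
  then show ?thesis by blast
qed

text \<open>
  The generators satisfy a linear differential equation over \<open>\<complex>[u]\<close> and are therefore entire. At a point
  \<open>z\<close> the vector of their values is an eigenvector, with eigenvalue \<open>b(z)\<close>, of a matrix of polynomials that
  describes the multiplication by \<open>b\<close>; it is nonzero because the generators combine to \<open>1\<close>. So \<open>b\<close> grows
  at most polynomially.
\<close>

theorem finitely_generated_differential_ring_polynomial:
  fixes S :: "complex fps set" and g :: "nat \<Rightarrow> complex fps"
  assumes one: "1 \<in> S" and mult: "\<And>x y. x \<in> S \<Longrightarrow> y \<in> S \<Longrightarrow> x * y \<in> S"
    and deriv: "\<And>x. x \<in> S \<Longrightarrow> fps_deriv x \<in> S"
    and g: "\<And>i. i < m \<Longrightarrow> g i \<in> S"
    and generate: "\<And>x. x \<in> S \<Longrightarrow> \<exists>c. x = (\<Sum>i<m. fps_of_poly (c i) * g i)"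
    and b: "b \<in> S"
  shows "\<exists>p. b = fps_of_poly p"
proof -
  have "\<exists>c. fps_deriv (g i) = (\<Sum>j<m. fps_of_poly (c j) * g j)" if "i < m" for i
    by (intro generate deriv g that)
  then obtain A where A: "\<And>i. i < m \<Longrightarrow> fps_deriv (g i) = (\<Sum>j<m. fps_of_poly (A i j) * g j)"
    by metis
  have g_entire: "fps_conv_radius (g i) = \<infinity>" if "i < m" for i
    using linear_ode_entire[OF A that] .
  have comb_eval: "eval_fps (\<Sum>i<m. fps_of_poly (c i) * g i) z = (\<Sum>i<m. poly (c i) z * eval_fps (g i) z)" for c z
    by (subst eval_fps_sum) (auto simp: entire_mult g_entire eval_fps_mult)
  have entire: "fps_conv_radius x = \<infinity>" if "x \<in> S" for x
  proof -
    obtain c where c: "x = (\<Sum>i<m. fps_of_poly (c i) * g i)" using generate[OF \<open>x \<in> S\<close>] by blast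
    show ?thesis unfolding c by (intro entire_sum entire_mult g_entire) auto
  qed
  have "\<exists>c. b * g i = (\<Sum>j<m. fps_of_poly (c j) * g j)" if "i < m" for i
    by (intro generate mult b g that)
  then obtain M where M: "\<And>i. i < m \<Longrightarrow> b * g i = (\<Sum>j<m. fps_of_poly (M i j) * g j)"
    by metis
  obtain u where u: "1 = (\<Sum>i<m. fps_of_poly (u i) * g i)" using generate[OF one] by blast
  have bound: "norm (eval_fps b z) \<le> (\<Sum>i<m. \<Sum>j<m. norm (poly (M i j) z))" for z
  proof -
    define G where "G = (\<Sum>i<m. norm (eval_fps (g i) z))"
    have "(\<Sum>i<m. poly (u i) z * eval_fps (g i) z) = 1"
      by (simp flip: comb_eval u)
    then have "\<exists>i<m. eval_fps (g i) z \<noteq> 0"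
      by (metis (no_types, lifting) lessThan_iff mult_zero_right sum.neutral zero_neq_one)
    then have "G > 0"
      unfolding G_def by (auto intro!: sum_pos2)
    have "norm (eval_fps b z) * G = (\<Sum>i<m. norm (eval_fps (b * g i) z))"
      by (simp add: G_def sum_distrib_left eval_fps_mult entire[OF b] g_entire norm_mult)
    also have "\<dots> = (\<Sum>i<m. norm (\<Sum>j<m. poly (M i j) z * eval_fps (g j) z))"
      by (simp add: M comb_eval)
    also have "\<dots> \<le> (\<Sum>i<m. \<Sum>j<m. norm (poly (M i j) z) * G)"
    proof (intro sum_mono order_trans[OF norm_sum])
      fix i j assume "i \<in> {..<m}" "j \<in> {..<m}"
      then have "norm (eval_fps (g j) z) \<le> G"
        unfolding G_def by (intro member_le_sum) auto
      then show "norm (poly (M i j) z * eval_fps (g j) z) \<le> norm (poly (M i j) z) * G"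
        by (simp add: norm_mult mult_left_mono)
    qed
    also have "\<dots> = (\<Sum>i<m. \<Sum>j<m. norm (poly (M i j) z)) * G"
      by (simp add: sum_distrib_right)
    finally show ?thesis using \<open>G > 0\<close> by simp
  qed
  define N where "N = (\<Sum>i<m. \<Sum>j<m. degree (M i j))"
  define C where "C = (\<Sum>i<m. \<Sum>j<m. \<Sum>k\<le>degree (M i j). norm (coeff (M i j) k))"
  have N: "degree (M i j) \<le> N" if "i < m" "j < m" for i j
  proof -
    have "degree (M i j) \<le> (\<Sum>j<m. degree (M i j))"
      using that by (intro member_le_sum) auto
    also have "\<dots> \<le> N"
      unfolding N_def using that by (intro member_le_sum) auto
    finally show ?thesis .
  qed
  have "norm (eval_fps b z) \<le> C * norm z ^ N" if "1 \<le> norm z" for z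
  proof -
    have "norm (eval_fps b z) \<le> (\<Sum>i<m. \<Sum>j<m. norm (poly (M i j) z))" by (rule bound)
    also have "\<dots> \<le> (\<Sum>i<m. \<Sum>j<m. (\<Sum>k\<le>degree (M i j). norm (coeff (M i j) k)) * norm z ^ N)"
      using N that by (intro sum_mono poly_norm_bound) auto
    finally show ?thesis by (simp add: C_def sum_distrib_right)
  qed
  then show ?thesis
    using entire_polynomial_growth_imp_polynomial[OF entire[OF b]] by blast
qed

lemma fps_to_fls_sum: "fps_to_fls (sum f I) = (\<Sum>i\<in>I. fps_to_fls (f i))"
  by (induction I rule: infinite_finite_induct) simp_all

text \<open>
  The field of Laurent series serves as the ambient field for the trace argument.
\<close>

theorem surjective_differential_subring_polynomial:
  fixes S :: "complex fps set"
  assumes add: "\<And>x y. x \<in> S \<Longrightarrow> y \<in> S \<Longrightarrow> x + y \<in> S"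
    and mult: "\<And>x y. x \<in> S \<Longrightarrow> y \<in> S \<Longrightarrow> x * y \<in> S"
    and polys: "\<And>p. fps_of_poly p \<in> S"
    and deriv: "fps_deriv ` S = S"
    and rank: "\<exists>m. \<forall>b :: nat \<Rightarrow> complex fps. (\<forall>i. b i \<in> S) \<longrightarrow>
      (\<exists>Q. (\<exists>i\<le>m. Q i \<noteq> 0) \<and> (\<Sum>i\<le>m. fps_of_poly (Q i) * b i) = 0)"
    and b: "b \<in> S"
  shows "\<exists>p. b = fps_of_poly p"
proof -
  let ?\<iota> = "\<lambda>p. fps_to_fls (fps_of_poly p) :: complex fls"
  interpret surjective_differential_ring ?\<iota> fls_deriv "fps_to_fls ` S"
  proof
    show "fls_deriv ` fps_to_fls ` S = fps_to_fls ` S"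
      unfolding image_image fls_deriv_fps_to_fls using deriv by (metis image_image)
    obtain m where m: "\<And>b :: nat \<Rightarrow> complex fps. (\<forall>i. b i \<in> S) \<Longrightarrow>
      \<exists>Q. (\<exists>i\<le>m. Q i \<noteq> 0) \<and> (\<Sum>i\<le>m. fps_of_poly (Q i) * b i) = 0"
      using rank by blast
    have "\<exists>Q. (\<exists>i\<le>m. Q i \<noteq> 0) \<and> (\<Sum>i\<le>m. ?\<iota> (Q i) * b i) = 0"
      if "\<forall>i. b i \<in> fps_to_fls ` S" for b :: "nat \<Rightarrow> complex fls"
    proof -
      obtain b' where b': "\<And>i. b' i \<in> S" "\<And>i. b i = fps_to_fls (b' i)"
        using \<open>\<forall>i. b i \<in> fps_to_fls ` S\<close> unfolding image_iff by metis
      then obtain Q where "\<exists>i\<le>m. Q i \<noteq> 0" "(\<Sum>i\<le>m. fps_of_poly (Q i) * b' i) = 0"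
        using m[of b'] by blast
      moreover have "(\<Sum>i\<le>m. ?\<iota> (Q i) * b i) = fps_to_fls (\<Sum>i\<le>m. fps_of_poly (Q i) * b' i)"
        by (simp add: fps_to_fls_sum b'(2) fls_times_fps_to_fls)
      ultimately show ?thesis by auto
    qed
    then show "\<exists>m. \<forall>b :: nat \<Rightarrow> complex fls. (\<forall>i. b i \<in> fps_to_fls ` S) \<longrightarrow>
        (\<exists>Q. (\<exists>i\<le>m. Q i \<noteq> 0) \<and> (\<Sum>i\<le>m. ?\<iota> (Q i) * b i) = 0)"
      by blast
  qed (auto simp: fps_of_poly_add fps_of_poly_mult fls_deriv_fps_to_fls
        fps_of_poly_pderiv polys image_iff
        simp flip: fps_to_fls_plus fls_times_fps_to_fls intro: add mult)
  obtain m :: nat and g where g: "\<forall>i<m. g i \<in> fps_to_fls ` S"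
    and gen: "\<forall>x\<in>fps_to_fls ` S. \<exists>c. x = (\<Sum>i<m. ?\<iota> (c i) * g i)"
    using finitely_generated by blast
  then have "\<forall>i. \<exists>h. i < m \<longrightarrow> h \<in> S \<and> g i = fps_to_fls h" by blast
  then obtain h where h: "\<And>i. i < m \<Longrightarrow> h i \<in> S" "\<And>i. i < m \<Longrightarrow> g i = fps_to_fls (h i)"
    by metis
  have "\<exists>c. x = (\<Sum>i<m. fps_of_poly (c i) * h i)" if "x \<in> S" for x
  proof -
    obtain c where "fps_to_fls x = (\<Sum>i<m. ?\<iota> (c i) * g i)"
      using gen \<open>x \<in> S\<close> by blast
    also have "\<dots> = fps_to_fls (\<Sum>i<m. fps_of_poly (c i) * h i)"
      by (simp add: fps_to_fls_sum h(2) fls_times_fps_to_fls)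
    finally show ?thesis by auto
  qed
  moreover have "1 \<in> S" using polys[of 1] by simp
  ultimately show ?thesis
    using finitely_generated_differential_ring_polynomial[of S m h b] mult deriv h(1) b by blast
qed

section \<open>Taylor expansion along a derivation\<close>

definition at_point :: "complex \<times> complex \<Rightarrow> cpoly2 \<Rightarrow> complex"
  where "at_point P a = poly (poly a [:snd P:]) (fst P)"

lemma at_point_hom [simp]:
  "at_point P (a + b) = at_point P a + at_point P b"
  "at_point P (a * b) = at_point P a * at_point P b"
  "at_point P (a - b) = at_point P a - at_point P b"
  "at_point P (const2 c) = c" "at_point P 0 = 0" "at_point P 1 = 1"
  by (simp_all add: at_point_def const2_def)

lemma at_point_sum: "at_point P (sum f I) = (\<Sum>i\<in>I. at_point P (f i))"
  by (induction I rule: infinite_finite_induct) simp_all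

lemma at_point_of_nat [simp]: "at_point P (of_nat n) = of_nat n"
  by (simp add: of_nat_eq_const2)

lemma nonconstant_has_zero:
  assumes "f \<notin> range const2"
  shows "\<exists>P. at_point P f = 0"
proof (cases "degree f = 0")
  case True
  then obtain q where q: "f = [:q:]" by (metis degree_eq_zeroE)
  have "degree q \<noteq> 0"
  proof
    assume "degree q = 0"
    then obtain c where "q = [:c:]" by (metis degree_eq_zeroE)
    with q assms show False by (simp add: const2_def)
  qed
  then obtain x where "poly q x = 0"
    using Fundamental_Theorem_Algebra.fundamental_theorem_of_algebra[of q] by (auto simp: constant_degree)
  then have "at_point (x, 0) f = 0" by (simp add: at_point_def q)
  then show ?thesis by blast
next
  case False
  then have "lead_coeff f \<noteq> 0" by auto
  then have "finite {x. poly (lead_coeff f) x = 0}" by (rule poly_roots_finite)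
  then obtain x where x: "poly (lead_coeff f) x \<noteq> 0"
    using ex_new_if_finite[OF infinite_UNIV_char_0] by blast
  define h where "h = map_poly (\<lambda>q. poly q x) f"
  have "coeff h (degree f) \<noteq> 0"
    using x by (simp add: h_def coeff_map_poly)
  then have "degree h \<noteq> 0"
    using False le_degree[of h "degree f"] by auto
  then obtain y where "poly h y = 0"
    using Fundamental_Theorem_Algebra.fundamental_theorem_of_algebra[of h] by (auto simp: constant_degree)
  moreover have "poly (map_poly (\<lambda>q. poly q x) a) y = at_point (x, y) a" for a
    by (induction a) (simp_all add: map_poly_pCons at_point_def)
  ultimately show ?thesis by (auto simp: h_def)
qed

lemma nonconstant_surjective:
  assumes "f \<notin> range const2"
  shows "\<exists>P. at_point P f = c"
proof -
  have "f - const2 c \<notin> range const2"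
  proof
    assume "f - const2 c \<in> range const2"
    then obtain k where "f - const2 c = const2 k" by blast
    then have "f = const2 (k + c)" by (simp add: const2_hom algebra_simps)
    with assms show False by blast
  qed
  then obtain P where "at_point P (f - const2 c) = 0"
    using nonconstant_has_zero by blast
  then have "at_point P f = c" by simp
  then show ?thesis by blast
qed

context plane_derivation
begin

definition taylor :: "complex \<times> complex \<Rightarrow> cpoly2 \<Rightarrow> complex fps"
  where "taylor P a = Abs_fps (\<lambda>k. at_point P ((D ^^ k) a) / fact k)"

lemma taylor_add: "taylor P (a + b) = taylor P a + taylor P b"
  by (rule fps_ext) (simp add: taylor_def iterate_add add_divide_distrib)

lemma taylor_mult: "taylor P (a * b) = taylor P a * taylor P b"
proof (rule fps_ext)
  fix k
  have "at_point P ((D ^^ k) (a * b)) / fact k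
      = (\<Sum>i\<le>k. of_nat (k choose i) * at_point P ((D ^^ i) a) * at_point P ((D ^^ (k - i)) b) / fact k)"
    by (simp add: iterated_Leibniz at_point_sum sum_divide_distrib)
  also have "\<dots> = (\<Sum>i\<le>k. (at_point P ((D ^^ i) a) / fact i) * (at_point P ((D ^^ (k - i)) b) / fact (k - i)))"
    by (intro sum.cong refl) (simp add: binomial_fact)
  finally show "taylor P (a * b) $ k = (taylor P a * taylor P b) $ k"
    by (simp add: taylor_def fps_mult_nth atLeast0AtMost)
qed

lemma taylor_D: "taylor P (D a) = fps_deriv (taylor P a)"
proof (rule fps_ext)
  fix k
  have "of_nat (Suc k) * (x / fact (Suc k)) = x / fact k" for x :: complex
    unfolding fact_Suc by (simp add: divide_simps del: of_nat_Suc)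
  then show "taylor P (D a) $ k = fps_deriv (taylor P a) $ k"
    by (simp add: taylor_def funpow_swap1 del: of_nat_Suc fact_Suc)
qed

lemma taylor_kernel:
  assumes "D a = 0"
  shows "taylor P a = fps_const (at_point P a)"
proof (rule fps_ext)
  fix k
  have "k > 0 \<Longrightarrow> (D ^^ k) a = 0"
    using assms iterate_vanishes_beyond[of 1 a k] by simp
  then show "taylor P a $ k = fps_const (at_point P a) $ k"
    by (cases "k = 0") (simp_all add: taylor_def)
qed

lemma taylor_const2 [simp]: "taylor P (const2 c) = fps_const c"
  by (simp add: taylor_kernel)

lemma taylor_0 [simp]: "taylor P 0 = 0"
  by (simp add: taylor_kernel)

lemma taylor_sum: "taylor P (sum f I) = (\<Sum>i\<in>I. taylor P (f i))"
  by (induction I rule: infinite_finite_induct) (simp_all add: taylor_add)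

lemma taylor_slice:
  assumes "D s = 1"
  shows "taylor P s = fps_of_poly [:at_point P s, 1:]"
proof (rule fps_ext)
  fix k
  show "taylor P s $ k = fps_of_poly [:at_point P s, 1:] $ k"
  proof (cases "k \<le> 1")
    case True
    then show ?thesis using assms by (auto simp: taylor_def le_Suc_eq)
  next
    case False
    then have "(D ^^ k) s = 0"
      using assms iterate_vanishes_beyond[of 2 s k] by (simp add: numeral_2_eq_2)
    moreover have "coeff [:at_point P s, 1:] k = 0"
      using False by (intro coeff_eq_0) simp
    ultimately show ?thesis by (simp add: taylor_def)
  qed
qed

lemma taylor_at_poly: "taylor P (at_poly q a) = (\<Sum>k\<le>degree q. fps_const (coeff q k) * taylor P a ^ k)"
proof -
  have pow: "taylor P (a ^ k) = taylor P a ^ k" for k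
    by (induction k) (simp_all add: taylor_mult taylor_kernel)
  have "at_poly q a = (\<Sum>k\<le>degree q. const2 (coeff q k) * a ^ k)"
    by (subst poly_as_sum_of_monoms[symmetric]) (simp only: at_poly_sum at_poly_monom)
  then show ?thesis by (simp add: taylor_sum taylor_mult pow)
qed

lemma taylor_at_poly_kernel:
  assumes "D a = 0"
  shows "taylor P (at_poly q a) = fps_const (poly q (at_point P a))"
proof -
  have "at_point P (at_poly q a) = poly q (at_point P a)"
    by (induction q) (simp_all add: at_poly_pCons)
  moreover have "D (at_poly q a) = 0"
    by (simp add: D_at_poly assms)
  ultimately show ?thesis by (simp add: taylor_kernel)
qed

lemma taylor_at_poly_slice:
  assumes "D s = 1" "at_point P s = 0"
  shows "taylor P (at_poly q s) = fps_of_poly q"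
proof -
  have "(\<Sum>k\<le>degree q. fps_const (coeff q k) * fps_X ^ k) = fps_of_poly q"
    by (subst (3) poly_as_sum_of_monoms[symmetric]) (simp add: fps_of_poly_sum fps_of_poly_monom)
  then show ?thesis
    using taylor_slice[OF assms(1), of P] by (simp add: taylor_at_poly assms(2))
qed

section \<open>Surjective derivations with a nonconstant first integral\<close>

text \<open>
  The expansion at \<open>P\<close> annihilates \<open>f0 = f - f(P)\<close>, so that the dimension count modulo \<open>f0\<close> bounds the rank of
  its image. The slice is normalised to vanish at \<open>P\<close>, which makes its expansion the variable \<open>u\<close>.
\<close>

lemma taylor_polynomial:
  assumes surj: "surj D" and f: "D f = 0" "f \<notin> range const2"
  shows "\<exists>q. taylor P a = fps_of_poly q"
proof -
  obtain s' where s': "D s' = 1" using surj by (metis surjE)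
  define s where "s = s' - const2 (at_point P s')"
  have s: "D s = 1" "at_point P s = 0"
    by (simp_all add: s_def D_diff s')
  define f0 where "f0 = f - const2 (at_point P f)"
  have "f0 \<noteq> 0" using f(2) by (auto simp: f0_def)
  have f0: "taylor P f0 = 0"
    using f(1) by (simp add: f0_def taylor_kernel D_diff)
  show ?thesis
  proof (rule surjective_differential_subring_polynomial[where S = "range (taylor P)"])
    show "fps_deriv ` range (taylor P) = range (taylor P)"
    proof -
      have "fps_deriv ` range (taylor P) = taylor P ` range D"
        by (simp add: image_image taylor_D)
      then show ?thesis using surj by simp
    qed
    show "fps_of_poly q \<in> range (taylor P)" for q
      by (metis taylor_at_poly_slice[OF s] rangeI)
    obtain m where m: "\<And>b :: nat \<Rightarrow> cpoly2. \<exists>Q. (\<exists>i\<le>m. Q i \<noteq> 0) \<and> f0 dvd (\<Sum>i\<le>m. at_poly (Q i) s * b i)"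
      using finite_rank_over_polynomials_modulo[OF \<open>f0 \<noteq> 0\<close>] by blast
    have "\<exists>Q. (\<exists>i\<le>m. Q i \<noteq> 0) \<and> (\<Sum>i\<le>m. fps_of_poly (Q i) * b i) = 0"
      if "\<forall>i. b i \<in> range (taylor P)" for b :: "nat \<Rightarrow> complex fps"
    proof -
      obtain b' where b': "\<And>i. b i = taylor P (b' i)"
        using \<open>\<forall>i. b i \<in> range (taylor P)\<close> unfolding image_iff by metis
      obtain Q h where Q: "\<exists>i\<le>m. Q i \<noteq> 0" "(\<Sum>i\<le>m. at_poly (Q i) s * b' i) = f0 * h"
        using m[of b'] unfolding dvd_def by blast
      have "(\<Sum>i\<le>m. fps_of_poly (Q i) * b i) = taylor P (\<Sum>i\<le>m. at_poly (Q i) s * b' i)"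
        by (simp add: taylor_sum taylor_mult taylor_at_poly_slice[OF s] b')
      also have "\<dots> = 0" by (simp add: Q(2) taylor_mult f0)
      finally show ?thesis using Q(1) by blast
    qed
    then show "\<exists>m. \<forall>b :: nat \<Rightarrow> complex fps. (\<forall>i. b i \<in> range (taylor P)) \<longrightarrow>
        (\<exists>Q. (\<exists>i\<le>m. Q i \<noteq> 0) \<and> (\<Sum>i\<le>m. fps_of_poly (Q i) * b i) = 0)"
      by blast
  qed (auto simp flip: taylor_add taylor_mult)
qed

lemma taylor_eventually_vanishes:
  assumes "surj D" "D f = 0" "f \<notin> range const2"
  shows "\<exists>n. taylor P ((D ^^ n) a) = 0"
proof -
  obtain q where "taylor P a = fps_of_poly q"
    using taylor_polynomial[OF assms] by blast
  then have "taylor P ((D ^^ n) a) = fps_of_poly ((pderiv ^^ n) q)" for n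
    by (induction n) (simp_all add: taylor_D fps_of_poly_pderiv)
  moreover have "(pderiv ^^ Suc (degree q)) q = 0"
    by (rule poly_eqI) (simp add: coeff_higher_pderiv coeff_eq_0 del: funpow.simps)
  ultimately show ?thesis by (metis fps_of_poly_0)
qed

lemma pcompose_monom: "pcompose (monom c n) l = smult c (l ^ n)"
  by (induction n) (simp_all add: monom_0 monom_Suc pcompose_pCons)

text \<open>
  If \<open>a \<noteq> 0\<close>, it divides a nontrivial expression \<open>\<Sum>\<^sub>i Q\<^sub>i(f) s\<^sup>i\<close>. At a point of the fibre \<open>f = c\<close> where the
  expansion of \<open>a\<close> vanishes, this becomes \<open>\<Sum>\<^sub>i Q\<^sub>i(c) (s(P) + u)\<^sup>i = 0\<close>, so every \<open>Q\<^sub>i\<close> vanishes at \<open>c\<close>.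
\<close>

lemma vanishing_on_infinitely_many_fibres:
  assumes s: "D s = 1" and f: "D f = 0" and inf: "infinite L"
    and van: "\<And>c. c \<in> L \<Longrightarrow> \<exists>P. at_point P f = c \<and> taylor P a = 0"
  shows "a = 0"
proof (rule ccontr)
  assume "a \<noteq> 0"
  then obtain m Q where Q: "\<exists>i\<le>m. Q i \<noteq> 0" "a dvd (\<Sum>i\<le>m. at_poly (Q i) f * s ^ i)"
    using finite_rank_over_polynomials_modulo[of a f] by metis
  then obtain h where h: "(\<Sum>i\<le>m. at_poly (Q i) f * s ^ i) = a * h" by blast
  have pow: "taylor P (s ^ k) = taylor P s ^ k" for k P
    by (induction k) (simp_all add: taylor_mult taylor_kernel)
  have root: "poly (Q i) c = 0" if c: "c \<in> L" and i: "i \<le> m" for c i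
  proof -
    obtain P where P: "at_point P f = c" "taylor P a = 0" using van[OF c] by blast
    define l where "l = [:at_point P s, 1:]"
    define q where "q = (\<Sum>i\<le>m. monom (poly (Q i) c) i)"
    have "fps_of_poly (pcompose q l) = taylor P (\<Sum>i\<le>m. at_poly (Q i) f * s ^ i)"
      by (simp only: q_def l_def pcompose_sum pcompose_monom fps_of_poly_sum fps_of_poly_smult fps_of_poly_power
          taylor_sum taylor_mult pow taylor_slice[OF s] taylor_at_poly_kernel[OF f] P(1))
    also have "\<dots> = 0" by (simp add: h taylor_mult P(2))
    finally have "fps_of_poly (pcompose q l) = fps_of_poly 0" by simp
    then have "pcompose q l = 0" by (simp only: fps_of_poly_eq_iff)
    then have "q = 0" by (rule pcompose_eq_0) (simp add: l_def)
    then have "coeff q i = 0" by simp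
    then show ?thesis using i by (simp add: q_def coeff_sum coeff_monom)
  qed
  obtain i where i: "i \<le> m" "Q i \<noteq> 0" using Q(1) by blast
  have "L \<subseteq> {c. poly (Q i) c = 0}" using root i(1) by blast
  with inf poly_roots_finite[OF i(2)] show False by (metis finite_subset)
qed

text \<open>
  On each fibre of \<open>f\<close> some iterate of \<open>a\<close> has expansion zero. Uncountably many fibres compete for countably
  many exponents, so one exponent works on infinitely many fibres.
\<close>

theorem surjective_imp_locally_nilpotent:
  assumes surj: "surj D" and f: "D f = 0" "f \<notin> range const2"
  shows "locally_nilpotent D"
proof -
  obtain s where s: "D s = 1" using surj by (metis surjE)
  have "\<exists>n. (D ^^ n) a = 0" for a
  proof -
    obtain P where P: "\<And>c. at_point (P c) f = c"
      using nonconstant_surjective[OF f(2)] by metis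
    have "\<forall>c. \<exists>n. taylor (P c) ((D ^^ n) a) = 0"
      using taylor_eventually_vanishes[OF surj f] by blast
    then obtain n where n: "\<And>c. taylor (P c) ((D ^^ n c) a) = 0" by metis
    have "\<exists>N. infinite {c. n c = N}"
    proof (rule ccontr)
      assume "\<not> ?thesis"
      then have "countable (\<Union>N. {c. n c = N})"
        by (intro countable_UN) (auto intro: countable_finite)
      moreover have "(\<Union>N. {c. n c = N}) = UNIV" by auto
      ultimately show False using uncountable_UNIV_complex by simp
    qed
    then obtain N where N: "infinite {c. n c = N}" by blast
    have "(D ^^ N) a = 0"
    proof (rule vanishing_on_infinitely_many_fibres[OF s f(1) N])
      fix c assume "c \<in> {c. n c = N}"
      then show "\<exists>P. at_point P f = c \<and> taylor P ((D ^^ N) a) = 0"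
        using P[of c] n[of c] by (intro exI[of _ "P c"]) auto
    qed
    then show ?thesis by blast
  qed
  then have "\<exists>n. (D ^^ Suc n) a = 0" for a
    by (metis D_0 funpow.simps(2) o_apply)
  then show ?thesis
    unfolding locally_nilpotent_def by (metis le_add1 plus_1_eq_Suc)
qed

end

theorem corollary2p4:
  fixes D :: "cpoly2 \<Rightarrow> cpoly2"
  assumes "C_derivation D"
    and "D \<noteq> (\<lambda>_. 0)"
    and "reduced_derivation D"
  shows "locally_nilpotent D \<longleftrightarrow> surj D \<and> range const2 \<subset> Ker D"
proof
  interpret plane_derivation D by standard (rule assms(1))
  assume "surj D \<and> range const2 \<subset> Ker D"
  then show "locally_nilpotent D"
    using surjective_imp_locally_nilpotent by (auto simp: Ker_def)
next
  assume "locally_nilpotent D"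
  then interpret locally_nilpotent_derivation D
    by unfold_locales (rule assms(1))
  have "\<not> (p dvd D varX \<and> p dvd D varY)" if "prime_elem p" for p
  proof -
    obtain f\<^sub>1 f\<^sub>2 where D: "D = (\<lambda>a. f\<^sub>1 * dX a + f\<^sub>2 * dY a)"
      and reduced: "\<not> (\<exists>p. irreducible p \<and> p dvd f\<^sub>1 \<and> p dvd f\<^sub>2)"
      using assms(3) unfolding reduced_derivation_def by blast
    have "irreducible p"
      using that by (rule prime_elem_imp_irreducible)
    with reduced show ?thesis
      by (simp only: C_derivation_coeffs[OF D]) blast
  qed
  then show "surj D \<and> range const2 \<subset> Ker D"
    by (intro surjective_and_nontrivial_kernel assms(2))
qed

end
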